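(* Let $\alpha:[0,T]\to\mathbb{R}$ be a deterministic measurable function, let $\lambda\ge0$, and let $\mu(dt)=\gamma(t,t)^{-1}dt$. For the hard threshold estimator $X+\xi^{\alpha,\lambda}(X)=(X_t+\xi^{\alpha,\lambda}_t(X_t))_{t\in[0,T]}$, where $$\xi^{\alpha,\lambda}_t(x)=-(x-\alpha(t))\,\mathbf{1}_{\{|x-\alpha(t)|<\lambda\sqrt{\gamma(t,t)}\}},\qquad x\in\mathbb{R},$$ we have almost surely $$\mathrm{SURE}_\mu(X+\xi^{\alpha,\lambda}(X))=T+\int_0^T\frac{(X_t-\alpha(t))^2}{\gamma(t,t)}\mathbf{1}_{\{|X_t-\alpha(t)|\le\lambda\sqrt{\gamma(t,t)}\}}\,dt+2\lambda\,\bar\ell^\lambda_T-2\bar L^\lambda_T,$$ where $\bar L^\lambda_T$ and $\bar\ell^\lambda_T$ are respectively the occupation time and the local time of $\big(|X_t-\alpha(t)|/\sqrt{\gamma(t,t)}\big)_{t\in[0,T]}$ defined in the context.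
   Context: Let $T>0$. Under a probability measure $\mathbb{P}_u$ (with expectation $\mathbb{E}_u$) on $\Omega$ one observes a (jointly measurable) real process $X=(X_t)_{t\in[0,T]}$ decomposed as $X_t=u(t)+X^u_t$, where $u$ is a deterministic measurable function and $(X^u_t)_{t\in[0,T]}$ is a centered Gaussian process with non-vanishing covariance function $\gamma(s,t)=\mathbb{E}_u[X^u_sX^u_t]$ (in particular $\gamma(t,t)>0$). "Almost surely" is with respect to $\mathbb{P}_u$. Let $Z_t=(X_t-\alpha(t))/\sqrt{\gamma(t,t)}$ and $$\Delta(s,t)=\mathrm{Var}_u(Z_t-Z_s)=2-2\frac{\gamma(s,t)}{\sqrt{\gamma(s,s)\gamma(t,t)}},$$ and assume the local time existence condition $\int_0^T\int_0^T\Delta(s,t)^{-1/2}\,ds\,dt<\infty$. The occupation time of $|Z|$ is $$\bar L^\lambda_T=\int_0^T\mathbf{1}_{\{|X_t-\alpha(t)|\le\lambda\sqrt{\gamma(t,t)}\}}\,dt,\qquad\lambda\ge0,$$ and its local time is $\bar\ell^\lambda_T=\frac{d}{d\lambda}\bar L^\lambda_T$, the derivative being taken in $L^2(\Omega,\mathbb{P}_u)$ (from the right if $\lambda=0$); it satisfies the occupation time density formula $\int_0^Tf(|Z_t|)\,dt=\int_0^\infty f(a)\,\bar\ell^a_T\,da$ for positive measurable $f$. The Stein Unbiased Risk Estimate of an estimator $X+\xi$ is $$\mathrm{SURE}_\mu(X+\xi)=\int_0^T\gamma(t,t)\,\mu(dt)+\int_0^T|\xi_t|^2\,\mu(dt)+2\int_0^TD_t\xi_t\,\mu(dt),$$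 where $D$ is the Malliavin-type gradient, which acts on smooth functions of $X_t$ by $D_tf(X_t)=\gamma(t,t)f'(X_t)$. For the discontinuous function $\xi^{\alpha,\lambda}_t$, the term $\int_0^TD_t\xi^{\alpha,\lambda}_t(X_t)\,\mu(dt)$ is understood as the limit in $L^2(\Omega,\mathbb{P}_u)$, as $\varepsilon\to0$, of $\int_0^TD_t\xi^{\alpha,\lambda,\varepsilon}_t(X_t)\,\mu(dt)$, where $\xi^{\alpha,\lambda,\varepsilon}_t=\phi_{\varepsilon\sqrt{\gamma(t,t)}}*\xi^{\alpha,\lambda}_t$ (convolution in $x$), $\phi_\eta(x)=\eta^{-1}\phi(\eta^{-1}x)$ for $\eta>0$, and $\phi\ge0$ is a $C^\infty$ function supported in $[-1,1]$, symmetric around the origin, with $\int_{-1}^1\phi(x)\,dx=1$. Part of the assertion is that this limit exists. *)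

theory Defs
  imports "HOL-Probability.Probability"
begin

(* Degenerate (almost surely constant) variables count as Gaussian. *)
definition gaussian_rv :: "'w measure \<Rightarrow> ('w \<Rightarrow> real) \<Rightarrow> bool" where
  "gaussian_rv M Y \<longleftrightarrow>
     (\<exists>m \<sigma>. \<sigma> > 0 \<and> distributed M lborel Y (normal_density m \<sigma>)) \<or>
     (\<exists>m. Y \<in> borel_measurable M \<and> (AE \<omega> in M. Y \<omega> = m))"

definition centered_gaussian_process ::
    "'w measure \<Rightarrow> 'i set \<Rightarrow> ('i \<Rightarrow> 'w \<Rightarrow> real) \<Rightarrow> bool" where
  "centered_gaussian_process M I Y \<longleftrightarrow>
     (\<forall>J c. finite J \<and> J \<subseteq> I \<longrightarrow> gaussian_rv M (\<lambda>\<omega>. \<Sum>t\<in>J. c t * Y t \<omega>)) \<and>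
     (\<forall>t\<in>I. (LINT \<omega>|M. Y t \<omega>) = 0)"

definition square_integrable :: "'w measure \<Rightarrow> ('w \<Rightarrow> real) \<Rightarrow> bool" where
  "square_integrable M Y \<longleftrightarrow>
     Y \<in> borel_measurable M \<and> integrable M (\<lambda>\<omega>. (Y \<omega>)\<^sup>2)"

definition L2_tendsto ::
    "'w measure \<Rightarrow> ('b \<Rightarrow> 'w \<Rightarrow> real) \<Rightarrow> ('w \<Rightarrow> real) \<Rightarrow> 'b filter \<Rightarrow> bool" where
  "L2_tendsto M Y Y0 F \<longleftrightarrow>
     (\<forall>\<^sub>F b in F. square_integrable M (Y b)) \<and> square_integrable M Y0 \<and>
     ((\<lambda>b. LINT \<omega>|M. (Y b \<omega> - Y0 \<omega>)\<^sup>2) \<longlongrightarrow> 0) F"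

definition normalized ::
    "(real \<Rightarrow> real \<Rightarrow> real) \<Rightarrow> (real \<Rightarrow> real) \<Rightarrow> (real \<Rightarrow> 'w \<Rightarrow> real) \<Rightarrow> real \<Rightarrow> 'w \<Rightarrow> real" where
  "normalized \<gamma> \<alpha> X t \<omega> = (X t \<omega> - \<alpha> t) / sqrt (\<gamma> t t)"

(* The integrand is ennreal-valued so that its value is \<infinity>, and not 0, where the variance
   of the increment vanishes. *)
definition local_time_condition ::
    "'w measure \<Rightarrow> real \<Rightarrow> (real \<Rightarrow> 'w \<Rightarrow> real) \<Rightarrow> bool" where
  "local_time_condition M T Z \<longleftrightarrow>
     (\<integral>\<^sup>+s\<in>{0..T}. (\<integral>\<^sup>+t\<in>{0..T}.
        inverse (ennreal (sqrt (prob_space.variance M (\<lambda>\<omega>. Z t \<omega> - Z s \<omega>)))) \<partial>lborel) \<partial>lborel) < \<infinity>"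

definition occupation_time ::
    "real \<Rightarrow> (real \<Rightarrow> real \<Rightarrow> real) \<Rightarrow> (real \<Rightarrow> real) \<Rightarrow> (real \<Rightarrow> 'w \<Rightarrow> real) \<Rightarrow> real \<Rightarrow> 'w \<Rightarrow> real" where
  "occupation_time T \<gamma> \<alpha> X l \<omega> =
     (LINT t:{0..T}|lborel. (if \<bar>X t \<omega> - \<alpha> t\<bar> \<le> l * sqrt (\<gamma> t t) then 1 else 0))"

(* The derivative is taken within {0..}: two-sided for l > 0, from the right for l = 0.
   As an L2 limit it is determined up to almost sure equality, hence a predicate. *)
definition is_local_time ::
    "'w measure \<Rightarrow> real \<Rightarrow> (real \<Rightarrow> real \<Rightarrow> real) \<Rightarrow> (real \<Rightarrow> real) \<Rightarrow> (real \<Rightarrow> 'w \<Rightarrow> real)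
      \<Rightarrow> real \<Rightarrow> ('w \<Rightarrow> real) \<Rightarrow> bool" where
  "is_local_time M T \<gamma> \<alpha> X l \<L> \<longleftrightarrow>
     L2_tendsto M
       (\<lambda>a \<omega>. (occupation_time T \<gamma> \<alpha> X a \<omega> - occupation_time T \<gamma> \<alpha> X l \<omega>) / (a - l))
       \<L> (at l within {0..})"

definition mollifier :: "(real \<Rightarrow> real) \<Rightarrow> bool" where
  "mollifier \<phi> \<longleftrightarrow>
     (\<forall>x. \<phi> x \<ge> 0) \<and>
     (\<forall>n x. (deriv ^^ n) \<phi> field_differentiable at x) \<and>
     (\<forall>x. \<bar>x\<bar> > 1 \<longrightarrow> \<phi> x = 0) \<and>
     (\<forall>x. \<phi> (- x) = \<phi> x) \<and>
     (LINT x:{-1..1}|lborel. \<phi> x) = 1"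

definition rescale :: "(real \<Rightarrow> real) \<Rightarrow> real \<Rightarrow> real \<Rightarrow> real" where
  "rescale \<phi> \<eta> x = \<phi> (x / \<eta>) / \<eta>"

definition convolve :: "(real \<Rightarrow> real) \<Rightarrow> (real \<Rightarrow> real) \<Rightarrow> real \<Rightarrow> real" where
  "convolve f g x = (LINT y|lborel. f y * g (x - y))"

definition mollify ::
    "(real \<Rightarrow> real \<Rightarrow> real) \<Rightarrow> (real \<Rightarrow> real) \<Rightarrow> real \<Rightarrow> (real \<Rightarrow> real \<Rightarrow> real) \<Rightarrow> real \<Rightarrow> real \<Rightarrow> real" where
  "mollify \<gamma> \<phi> \<epsilon> \<xi> t = convolve (rescale \<phi> (\<epsilon> * sqrt (\<gamma> t t))) (\<xi> t)"

(* D_t f(X_t) = \<gamma>(t,t) f'(X_t), as a function of the value x of X_t. *)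
definition grad :: "(real \<Rightarrow> real \<Rightarrow> real) \<Rightarrow> (real \<Rightarrow> real \<Rightarrow> real) \<Rightarrow> real \<Rightarrow> real \<Rightarrow> real" where
  "grad \<gamma> \<xi> t x = \<gamma> t t * deriv (\<xi> t) x"

(* \<D> is the integral of D_t \<xi>_t(X_t) with respect to \<mu>(dt) for a possibly discontinuous \<xi>.
   The first conjunct excludes the default value 0 of a divergent Bochner integral. *)
definition is_grad_integral ::
    "'w measure \<Rightarrow> (real \<Rightarrow> real \<Rightarrow> real) \<Rightarrow> real measure \<Rightarrow> (real \<Rightarrow> real)
      \<Rightarrow> (real \<Rightarrow> 'w \<Rightarrow> real) \<Rightarrow> (real \<Rightarrow> real \<Rightarrow> real) \<Rightarrow> ('w \<Rightarrow> real) \<Rightarrow> bool" where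
  "is_grad_integral M \<gamma> \<mu> \<phi> X \<xi> \<D> \<longleftrightarrow>
     (\<forall>\<epsilon>>0. AE \<omega> in M. integrable \<mu> (\<lambda>t. grad \<gamma> (mollify \<gamma> \<phi> \<epsilon> \<xi>) t (X t \<omega>))) \<and>
     L2_tendsto M (\<lambda>\<epsilon> \<omega>. LINT t|\<mu>. grad \<gamma> (mollify \<gamma> \<phi> \<epsilon> \<xi>) t (X t \<omega>)) \<D> (at_right 0)"

(* The risk estimate of X + \<xi>(X), where \<D> is the gradient integral of \<xi>. *)
definition SURE ::
    "(real \<Rightarrow> real \<Rightarrow> real) \<Rightarrow> real measure \<Rightarrow> (real \<Rightarrow> 'w \<Rightarrow> real)
      \<Rightarrow> (real \<Rightarrow> real \<Rightarrow> real) \<Rightarrow> ('w \<Rightarrow> real) \<Rightarrow> 'w \<Rightarrow> real" where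
  "SURE \<gamma> \<mu> X \<xi> \<D> \<omega> =
     (LINT t|\<mu>. \<gamma> t t) + (LINT t|\<mu>. \<bar>\<xi> t (X t \<omega>)\<bar>\<^sup>2) + 2 * \<D> \<omega>"

definition hard_threshold ::
    "(real \<Rightarrow> real \<Rightarrow> real) \<Rightarrow> (real \<Rightarrow> real) \<Rightarrow> real \<Rightarrow> real \<Rightarrow> real \<Rightarrow> real" where
  "hard_threshold \<gamma> \<alpha> l t x =
     - (x - \<alpha> t) * (if \<bar>x - \<alpha> t\<bar> < l * sqrt (\<gamma> t t) then 1 else 0)"

definition risk_measure :: "real \<Rightarrow> (real \<Rightarrow> real \<Rightarrow> real) \<Rightarrow> real measure" where
  "risk_measure T \<gamma> = density (restrict_space lborel {0..T}) (\<lambda>t. ennreal (1 / \<gamma> t t))"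

end

theory Submission
  imports Defs
begin

text \<open>
  Put \<open>Z\<^sub>t = (X\<^sub>t - \<alpha>(t)) / \<surd>\<gamma>(t,t)\<close>, a Gaussian process of unit variance.
  With the weight \<open>\<mu>(dt) = dt / \<gamma>(t,t)\<close> every term of the risk estimate becomes a time integral
  \<open>S f = \<integral> f (Z\<^sub>t) dt\<close> of a fixed function \<open>f\<close> of the normalized process. For the mollified
  threshold function this function is
  \<open>- (1\<^bsub>[-\<lambda>,\<lambda>]\<^esub> * \<phi>\<^sub>\<epsilon>)(z) + \<lambda> (\<phi>\<^sub>\<epsilon> (z - \<lambda>) + \<phi>\<^sub>\<epsilon> (z + \<lambda>))\<close>: the slope \<open>-1\<close> of the threshold function
  inside the window gives the first part, its two upward jumps of height \<open>\<lambda>\<close> give the second.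
  The difference quotients of the occupation time are \<open>S f\<close> as well, with \<open>f\<close> the sum of two
  normalized indicators next to \<open>\<lambda>\<close> and \<open>-\<lambda>\<close>. So everything follows once \<open>S f\<close> is known to
  converge in \<open>L\<^sup>2\<close>, to a limit that is independent of the choice of \<open>f\<close>, when \<open>f\<close> runs through
  probability densities that concentrate at one point \<open>c\<close>
  (\<open>approx_delta_L2_close\<close>, \<open>local_time_at_level\<close>).

  This is shown with second moments. For two such densities put \<open>h = f - g\<close>; then
  \<open>E (S f - S g)\<^sup>2 = \<integral>\<integral> E h(Z\<^sub>s) h(Z\<^sub>t) ds dt\<close>. Let \<open>\<rho>\<close> be the correlation of \<open>Z\<^sub>s\<close> and
  \<open>Z\<^sub>t\<close> and \<open>\<kappa> = \<surd>(1 - \<rho>\<^sup>2)\<close>. Given \<open>Z\<^sub>s\<close>, the variable \<open>Z\<^sub>t\<close> is normal with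
  standard deviation \<open>\<kappa>\<close>; because \<open>h\<close> has integral zero and lives within distance \<open>r\<close> of \<open>c\<close>, the
  conditional mean of \<open>h (Z\<^sub>t)\<close> is at most \<open>2 min (1/\<kappa>) (r/\<kappa>\<^sup>2)\<close> in absolute value
  (\<open>two_point_bound\<close>). Dominated convergence finishes the argument as \<open>r\<close> tends to zero, provided that \<open>1/\<kappa>\<close> is integrable over pairs of times.

  The local time condition only bounds \<open>(1 - \<rho>)\<^bsup>-1/2\<^esup>\<close>, so correlations near \<open>-1\<close> need a
  separate reason: positive definiteness. The inequality \<open>0 \<le> E (\<integral> sin (y W\<^sub>t) dt)\<^sup>2\<close>, with
  \<open>W\<^sub>t = (X\<^sub>t - u(t)) / \<surd>\<gamma>(t,t)\<close>, says that
  \<open>\<integral>\<integral> exp (- y\<^sup>2 (1 + \<rho>)) \<le> \<integral>\<integral> exp (- y\<^sup>2 (1 - \<rho>))\<close>, and integrating over \<open>y\<close> gives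
  \<open>\<integral>\<integral> (1 + \<rho>)\<^bsup>-1/2\<^esup> \<le> \<integral>\<integral> (1 - \<rho>)\<^bsup>-1/2\<^esup>\<close> (\<open>energy_reflection\<close>).
\<close>

section \<open>Square-integrable functions and convergence in mean square\<close>

lemma square_integrable_mult:
  assumes "square_integrable M f" "square_integrable M g"
  shows "integrable M (\<lambda>x. f x * g x)"
proof (rule Bochner_Integration.integrable_bound)
  show "integrable M (\<lambda>x. (f x)\<^sup>2 + (g x)\<^sup>2)"
    using assms by (auto simp: square_integrable_def)
  have "\<bar>a * b\<bar> \<le> a\<^sup>2 + b\<^sup>2" for a b :: real
    using zero_le_power2[of "\<bar>a\<bar> - \<bar>b\<bar>"] mult_nonneg_nonneg[OF abs_ge_zero[of a] abs_ge_zero[of b]]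
    unfolding abs_mult power2_diff power2_abs by linarith
  then show "AE x in M. norm (f x * g x) \<le> norm ((f x)\<^sup>2 + (g x)\<^sup>2)"
    by auto
qed (use assms in \<open>auto simp: square_integrable_def\<close>)

lemma square_integrable_lincomb:
  assumes "square_integrable M f" "square_integrable M g"
  shows "square_integrable M (\<lambda>x. a * f x + b * g x)"
proof -
  have "integrable M (\<lambda>x. a\<^sup>2 * (f x)\<^sup>2 + b\<^sup>2 * (g x)\<^sup>2 + 2 * a * b * (f x * g x))"
    using assms square_integrable_mult[OF assms]
    by (intro Bochner_Integration.integrable_add integrable_mult_right)
       (auto simp: square_integrable_def)
  then show ?thesis
    using assms by (auto simp: square_integrable_def power2_sum power_mult_distrib mult_ac)
qed

lemma square_integrable_diff:
  assumes "square_integrable M f" "square_integrable M g"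
  shows "square_integrable M (\<lambda>x. f x - g x)"
  using square_integrable_lincomb[OF assms, of 1 "-1"] by simp

lemma (in finite_measure) square_integrable_bounded:
  assumes "f \<in> borel_measurable M" "\<And>x. x \<in> space M \<Longrightarrow> \<bar>f x\<bar> \<le> B"
  shows "square_integrable M f"
  unfolding square_integrable_def
proof
  have "(f x)\<^sup>2 \<le> B\<^sup>2" if "x \<in> space M" for x
    using assms(2)[OF that] by (metis abs_ge_zero power2_abs power_mono)
  then show "integrable M (\<lambda>x. (f x)\<^sup>2)"
    using assms(1) by (intro integrable_const_bound[where B="B\<^sup>2"]) auto
qed fact

lemma L2_dist_triangle:
  assumes "square_integrable M f" "square_integrable M g" "square_integrable M h"
  shows "(LINT x|M. (f x - h x)\<^sup>2) \<le> 2 * (LINT x|M. (f x - g x)\<^sup>2) + 2 * (LINT x|M. (g x - h x)\<^sup>2)"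
proof -
  have i: "integrable M (\<lambda>x. (f x - h x)\<^sup>2)" "integrable M (\<lambda>x. (f x - g x)\<^sup>2)"
    "integrable M (\<lambda>x. (g x - h x)\<^sup>2)"
    using assms square_integrable_diff by (auto simp: square_integrable_def)
  have "(f x - h x)\<^sup>2 \<le> 2 * (f x - g x)\<^sup>2 + 2 * (g x - h x)\<^sup>2" for x
    using zero_le_power2[of "(f x - g x) - (g x - h x)"] by (simp add: power2_eq_square algebra_simps)
  then have "(LINT x|M. (f x - h x)\<^sup>2) \<le> (LINT x|M. 2 * (f x - g x)\<^sup>2 + 2 * (g x - h x)\<^sup>2)"
    using i by (intro integral_mono) auto
  then show ?thesis using i by simp
qed

lemma L2_tendsto_lincomb:
  assumes f: "L2_tendsto M f f0 F" and g: "L2_tendsto M g g0 F"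
  shows "L2_tendsto M (\<lambda>b x. u * f b x + v * g b x) (\<lambda>x. u * f0 x + v * g0 x) F"
  unfolding L2_tendsto_def
proof (intro conjI)
  have ev: "\<forall>\<^sub>F b in F. square_integrable M (f b) \<and> square_integrable M (g b)"
    using f g by (simp add: L2_tendsto_def eventually_conj)
  have 0: "square_integrable M f0" "square_integrable M g0"
    using f g by (simp_all add: L2_tendsto_def)
  show "\<forall>\<^sub>F b in F. square_integrable M (\<lambda>x. u * f b x + v * g b x)"
    using ev by eventually_elim (simp add: square_integrable_lincomb)
  show "square_integrable M (\<lambda>x. u * f0 x + v * g0 x)"
    by (intro square_integrable_lincomb 0)
  let ?d = "\<lambda>b. 2 * u\<^sup>2 * (LINT x|M. (f b x - f0 x)\<^sup>2) + 2 * v\<^sup>2 * (LINT x|M. (g b x - g0 x)\<^sup>2)"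
  have "(?d \<longlongrightarrow> 2 * u\<^sup>2 * 0 + 2 * v\<^sup>2 * 0) F"
    using f g by (intro tendsto_intros) (simp_all add: L2_tendsto_def)
  then have lim: "(?d \<longlongrightarrow> 0) F" by simp
  show "((\<lambda>b. LINT x|M. (u * f b x + v * g b x - (u * f0 x + v * g0 x))\<^sup>2) \<longlongrightarrow> 0) F"
  proof (rule tendsto_sandwich[OF _ _ tendsto_const lim])
    show "\<forall>\<^sub>F b in F. (LINT x|M. (u * f b x + v * g b x - (u * f0 x + v * g0 x))\<^sup>2) \<le> ?d b"
      using ev
    proof eventually_elim
      case (elim b)
      let ?p = "\<lambda>x. f b x - f0 x" and ?q = "\<lambda>x. g b x - g0 x"
      have pq: "square_integrable M ?p" "square_integrable M ?q"
        using elim 0 by (auto intro: square_integrable_diff)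
      have "(LINT x|M. (u * ?p x + v * ?q x)\<^sup>2) \<le> (LINT x|M. 2 * u\<^sup>2 * (?p x)\<^sup>2 + 2 * v\<^sup>2 * (?q x)\<^sup>2)"
      proof (rule integral_mono)
        show "integrable M (\<lambda>x. (u * ?p x + v * ?q x)\<^sup>2)"
          using square_integrable_lincomb[OF pq] by (simp add: square_integrable_def)
        show "integrable M (\<lambda>x. 2 * u\<^sup>2 * (?p x)\<^sup>2 + 2 * v\<^sup>2 * (?q x)\<^sup>2)"
          using pq by (simp add: square_integrable_def)
        fix x show "(u * ?p x + v * ?q x)\<^sup>2 \<le> 2 * u\<^sup>2 * (?p x)\<^sup>2 + 2 * v\<^sup>2 * (?q x)\<^sup>2"
          using zero_le_power2[of "u * ?p x - v * ?q x"] by (simp add: power2_eq_square algebra_simps)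
      qed
      also have "\<dots> = ?d b"
        using pq by (simp add: square_integrable_def)
      finally show ?case by (simp add: algebra_simps)
    qed
  qed simp
qed

lemma L2_tendsto_cong:
  assumes "L2_tendsto M f g F"
    and ff: "\<forall>\<^sub>F b in F. \<forall>x\<in>space M. f b x = f' b x" and gg: "\<And>x. x \<in> space M \<Longrightarrow> g x = g' x"
  shows "L2_tendsto M f' g' F"
proof -
  have sq: "square_integrable M h'" if "square_integrable M h" "\<And>x. x \<in> space M \<Longrightarrow> h x = h' x" for h h'
    using that unfolding square_integrable_def
    by (metis (no_types, lifting) measurable_cong Bochner_Integration.integrable_cong)
  have ev: "\<forall>\<^sub>F b in F. square_integrable M (f b)" and g: "square_integrable M g"
    and lim: "((\<lambda>b. LINT x|M. (f b x - g x)\<^sup>2) \<longlongrightarrow> 0) F"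
    using assms(1) by (auto simp: L2_tendsto_def)
  have "\<forall>\<^sub>F b in F. (LINT x|M. (f b x - g x)\<^sup>2) = (LINT x|M. (f' b x - g' x)\<^sup>2)"
    using ff by eventually_elim (intro Bochner_Integration.integral_cong, auto simp: gg)
  moreover have "\<forall>\<^sub>F b in F. square_integrable M (f' b)"
    using ev ff by eventually_elim (metis sq)
  ultimately show ?thesis
    unfolding L2_tendsto_def using sq[OF g gg] lim by (auto simp: tendsto_cong)
qed

lemma L2_tendsto_unique:
  assumes F: "F \<noteq> bot" and f: "L2_tendsto M f g F" and h: "L2_tendsto M f h F"
  shows "AE x in M. g x = h x"
proof -
  have gh: "square_integrable M g" "square_integrable M h"
    using f h by (simp_all add: L2_tendsto_def)
  have "L2_tendsto M (\<lambda>b x. 1 * f b x + (-1) * f b x) (\<lambda>x. 1 * g x + (-1) * h x) F"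
    by (rule L2_tendsto_lincomb[OF f h])
  then have "((\<lambda>b. LINT x|M. (g x - h x)\<^sup>2) \<longlongrightarrow> 0) F"
    by (simp add: L2_tendsto_def power2_commute)
  then have "(LINT x|M. (g x - h x)\<^sup>2) = 0"
    using F by (simp add: tendsto_const_iff)
  moreover have "integrable M (\<lambda>x. (g x - h x)\<^sup>2)"
    using square_integrable_diff[OF gh] by (simp add: square_integrable_def)
  ultimately have "AE x in M. (g x - h x)\<^sup>2 = 0"
    by (subst (asm) integral_nonneg_eq_0_iff_AE) auto
  then show ?thesis by simp
qed

text \<open>On a probability space an \<open>L\<^sup>2\<close> Cauchy sequence is \<open>L\<^sup>1\<close> Cauchy, hence has an almost
  surely convergent subsequence; Fatou's lemma bounds the \<open>L\<^sup>2\<close> distance to its limit.\<close>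
lemma (in prob_space) L2_complete:
  fixes f :: "nat \<Rightarrow> 'a \<Rightarrow> real"
  assumes f: "\<And>n. square_integrable M (f n)"
    and cauchy: "\<And>e. e > 0 \<Longrightarrow> \<exists>N. \<forall>m\<ge>N. \<forall>n\<ge>N. (LINT x|M. (f m x - f n x)\<^sup>2) \<le> e"
  shows "\<exists>g. square_integrable M g \<and> (\<lambda>n. LINT x|M. (f n x - g x)\<^sup>2) \<longlonglongrightarrow> 0"
proof -
  have [measurable]: "f n \<in> borel_measurable M" for n
    using f by (simp add: square_integrable_def)
  have sqi: "integrable M (\<lambda>x. (f m x - f n x)\<^sup>2)" for m n
    using square_integrable_diff[OF f f] by (simp add: square_integrable_def)
  have int: "integrable M h" if "square_integrable M h" for h :: "'a \<Rightarrow> real"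
    using square_integrable_imp_integrable that by (auto simp: square_integrable_def)
  have L1: "\<exists>N. \<forall>i\<ge>N. \<forall>j\<ge>N. (LINT x|M. norm (f i x - f j x)) < e" if "e > 0" for e
  proof -
    from cauchy[of "(e/2)\<^sup>2"] that obtain N where
      N: "\<And>m n. m \<ge> N \<Longrightarrow> n \<ge> N \<Longrightarrow> (LINT x|M. (f m x - f n x)\<^sup>2) \<le> (e/2)\<^sup>2" by auto
    have "(LINT x|M. norm (f i x - f j x)) < e" if "i \<ge> N" "j \<ge> N" for i j
    proof -
      have "(LINT x|M. \<bar>f i x - f j x\<bar>)\<^sup>2 \<le> (LINT x|M. \<bar>f i x - f j x\<bar>\<^sup>2)"
      proof -
        have "0 \<le> variance (\<lambda>x. \<bar>f i x - f j x\<bar>)" by (rule variance_positive)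
        also have "\<dots> = (LINT x|M. \<bar>f i x - f j x\<bar>\<^sup>2) - (LINT x|M. \<bar>f i x - f j x\<bar>)\<^sup>2"
          using sqi[of i j] int[OF square_integrable_diff[OF f f], of i j] by (subst variance_eq) auto
        finally show ?thesis by simp
      qed
      also have "\<dots> \<le> (e/2)\<^sup>2" using N[OF that] by simp
      finally have "(LINT x|M. \<bar>f i x - f j x\<bar>) \<le> e/2"
        using \<open>e > 0\<close> by (simp add: power2_le_iff_abs_le)
      then show ?thesis using \<open>e > 0\<close> by simp
    qed
    then show ?thesis by blast
  qed
  obtain r where r: "strict_mono r" and ae: "AE x in M. Cauchy (\<lambda>i. f (r i) x)"
    using cauchy_L1_AE_cauchy_subseq[OF int[OF f] L1] by blast
  define g where "g x = lim (\<lambda>i. f (r i) x)" for x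
  have [measurable]: "g \<in> borel_measurable M"
    unfolding g_def by measurable
  have conv: "AE x in M. (\<lambda>i. f (r i) x) \<longlonglongrightarrow> g x"
    using ae by eventually_elim (simp add: g_def Cauchy_convergent_iff convergent_LIMSEQ_iff)
  have fatou: "(\<integral>\<^sup>+x. ennreal ((f n x - g x)\<^sup>2) \<partial>M) \<le> ennreal e"
    if "e > 0" and N: "\<And>m. m \<ge> N \<Longrightarrow> (LINT x|M. (f n x - f m x)\<^sup>2) \<le> e" for n N e
  proof -
    have "(\<integral>\<^sup>+x. ennreal ((f n x - g x)\<^sup>2) \<partial>M) = (\<integral>\<^sup>+x. liminf (\<lambda>i. ennreal ((f n x - f (r i) x)\<^sup>2)) \<partial>M)"
    proof (rule nn_integral_cong_AE)
      show "AE x in M. ennreal ((f n x - g x)\<^sup>2) = liminf (\<lambda>i. ennreal ((f n x - f (r i) x)\<^sup>2))"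
        using conv
      proof eventually_elim
        case (elim x)
        have "(\<lambda>i. ennreal ((f n x - f (r i) x)\<^sup>2)) \<longlonglongrightarrow> ennreal ((f n x - g x)\<^sup>2)"
          by (intro tendsto_ennrealI tendsto_intros elim)
        then show ?case by (rule lim_imp_Liminf[symmetric, rotated]) simp
      qed
    qed
    also have "\<dots> \<le> liminf (\<lambda>i. \<integral>\<^sup>+x. ennreal ((f n x - f (r i) x)\<^sup>2) \<partial>M)"
      by (rule nn_integral_liminf) simp
    also have "\<dots> \<le> ennreal e"
    proof (rule Liminf_le)
      show "\<forall>\<^sub>F i in sequentially. (\<integral>\<^sup>+x. ennreal ((f n x - f (r i) x)\<^sup>2) \<partial>M) \<le> ennreal e"
        using eventually_ge_at_top[of N]
      proof eventually_elim
        case (elim i)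
        then have "r i \<ge> N" using seq_suble[OF r, of i] by simp
        then show ?case
          using N[of "r i"] sqi[of n "r i"] by (simp add: nn_integral_eq_integral ennreal_leI)
      qed
    qed simp
    finally show ?thesis .
  qed
  have sq_g: "square_integrable M g"
  proof -
    obtain N where N: "\<And>m n. m \<ge> N \<Longrightarrow> n \<ge> N \<Longrightarrow> (LINT x|M. (f m x - f n x)\<^sup>2) \<le> 1"
      using cauchy[of 1] by auto
    have "(\<integral>\<^sup>+x. ennreal ((f N x - g x)\<^sup>2) \<partial>M) \<le> ennreal 1"
      by (rule fatou[of 1 N]) (use N in auto)
    then have "integrable M (\<lambda>x. (f N x - g x)\<^sup>2)"
      by (intro integrableI_bounded) (auto simp: le_less_trans)
    then have "square_integrable M (\<lambda>x. f N x - g x)"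
      by (simp add: square_integrable_def)
    from square_integrable_diff[OF f this, of N] show ?thesis by simp
  qed
  have "(\<lambda>n. LINT x|M. (f n x - g x)\<^sup>2) \<longlonglongrightarrow> 0"
  proof (rule LIMSEQ_I)
    fix e :: real assume "e > 0"
    then obtain N where N: "\<And>m n. m \<ge> N \<Longrightarrow> n \<ge> N \<Longrightarrow> (LINT x|M. (f m x - f n x)\<^sup>2) \<le> e/2"
      using cauchy[of "e/2"] by auto
    have "norm ((LINT x|M. (f n x - g x)\<^sup>2) - 0) < e" if "n \<ge> N" for n
    proof -
      have "(\<integral>\<^sup>+x. ennreal ((f n x - g x)\<^sup>2) \<partial>M) \<le> ennreal (e/2)"
        by (rule fatou[of "e/2" N]) (use N that \<open>e > 0\<close> in auto)
      moreover have "integrable M (\<lambda>x. (f n x - g x)\<^sup>2)"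
        using square_integrable_diff[OF f sq_g] by (simp add: square_integrable_def)
      ultimately have "(LINT x|M. (f n x - g x)\<^sup>2) \<le> e/2"
        using \<open>e > 0\<close> by (simp add: nn_integral_eq_integral)
      then show ?thesis using \<open>e > 0\<close> by (simp add: le_less_trans)
    qed
    then show "\<exists>N. \<forall>n\<ge>N. norm ((LINT x|M. (f n x - g x)\<^sup>2) - 0) < e" by blast
  qed
  with sq_g show ?thesis by blast
qed

section \<open>Uncorrelated jointly Gaussian variables are independent\<close>

text \<open>The image under \<open>V\<close> of the finite measure with density \<open>F\<close> has, up to the factor \<open>c\<close>, the
  Fourier transform of the standard normal law, and Levy's uniqueness theorem applies. Weights \<open>F\<close>
  that depend on another variable make this a tool for joint laws.\<close>
lemma (in prob_space) gaussian_char_weighted: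
  fixes V F :: "'a \<Rightarrow> real"
  assumes [measurable]: "V \<in> borel_measurable M" "F \<in> borel_measurable M"
    and F: "\<And>\<omega>. \<omega> \<in> space M \<Longrightarrow> 0 \<le> F \<omega>" "\<And>\<omega>. \<omega> \<in> space M \<Longrightarrow> F \<omega> \<le> B"
    and char: "\<And>b. (CLINT \<omega>|M. F \<omega> * iexp (b * V \<omega>)) = complex_of_real (c * exp (- b\<^sup>2 / 2))"
    and A: "A \<in> sets borel"
  shows "(LINT \<omega>|M. F \<omega> * indicator A (V \<omega>)) = c * measure std_normal_distribution A"
proof -
  have intF: "integrable M F"
    by (rule integrable_const_bound[where B=B]) (use F in auto)
  have "complex_of_real (LINT \<omega>|M. F \<omega>) = complex_of_real c"
    using char[of 0] by (simp flip: integral_complex_of_real)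
  then have c: "(LINT \<omega>|M. F \<omega>) = c"
    by (simp only: of_real_eq_iff)
  then have "c \<ge> 0"
    using F(1) by (auto intro!: Bochner_Integration.integral_nonneg)
  show ?thesis
  proof (cases "c = 0")
    case True
    then have "AE \<omega> in M. F \<omega> = 0"
      using integral_nonneg_eq_0_iff_AE[OF intF] F(1) c by auto
    then have "(LINT \<omega>|M. F \<omega> * indicator A (V \<omega>)) = (LINT \<omega>|M. 0)"
      by (intro integral_cong_AE) (use A in auto)
    then show ?thesis using True by simp
  next
    case False
    with \<open>c \<ge> 0\<close> have cpos: "c > 0" by simp
    let ?D = "density M (\<lambda>\<omega>. ennreal (F \<omega> / c))"
    let ?\<nu> = "distr ?D borel V"
    have nn: "AE \<omega> in M. 0 \<le> F \<omega> / c"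
      using F(1) cpos by auto
    have "emeasure ?D (space ?D) = ennreal (LINT \<omega>|M. F \<omega> / c)"
      using nn_integral_eq_integral[OF integrable_divide_zero[of c, OF _] nn] intF cpos
      by (auto simp: emeasure_density cong: nn_integral_cong)
    also have "\<dots> = 1" using c cpos by simp
    finally have "prob_space ?D" by (rule prob_spaceI)
    then interpret D: prob_space ?D .
    have rd: "real_distribution ?\<nu>"
      by (rule D.real_distribution_distr) simp
    have "char ?\<nu> b = char std_normal_distribution b" for b
    proof -
      have "char ?\<nu> b = (CLINT \<omega>|?D. iexp (b * V \<omega>))"
        unfolding char_def by (subst integral_distr) auto
      also have "\<dots> = (CLINT \<omega>|M. (F \<omega> / c) *\<^sub>R iexp (b * V \<omega>))"
        using nn by (subst integral_density) auto
      also have "\<dots> = (CLINT \<omega>|M. (F \<omega> * iexp (b * V \<omega>)) / c)"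
        by (simp add: scaleR_conv_of_real)
      also have "\<dots> = (c * exp (- b\<^sup>2 / 2)) / c"
        by (subst integral_divide_zero) (simp only: char of_real_divide)
      finally show ?thesis
        using cpos by (simp add: char_std_normal_distribution)
    qed
    then have eq: "?\<nu> = std_normal_distribution"
      by (intro Levy_uniqueness[OF rd real_dist_normal_dist]) auto
    have "measure std_normal_distribution A = (LINT x|?\<nu>. indicator A x)"
      using A by (simp add: eq)
    also have "\<dots> = (LINT \<omega>|?D. indicator A (V \<omega>))"
      using A by (subst integral_distr) auto
    also have "\<dots> = (LINT \<omega>|M. (F \<omega> / c) *\<^sub>R indicator A (V \<omega>))"
      using nn A by (subst integral_density) auto
    also have "\<dots> = (LINT \<omega>|M. F \<omega> * indicator A (V \<omega>)) / c"
      by simp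
    finally show ?thesis using cpos by simp
  qed
qed

text \<open>The one-dimensional uniqueness theorem is used twice. With oscillating weights in \<open>U\<close> it shows
  that the mean of \<open>exp (\<i> a U)\<close> over \<open>V \<in> B\<close> is \<open>exp (- a\<^sup>2 / 2)\<close> times the normal
  measure of \<open>B\<close>; for fixed \<open>B\<close> this is a statement about \<open>U\<close> with the indicator of
  \<open>V \<in> B\<close> as weight, and it yields the measure of \<open>U \<in> A, V \<in> B\<close>.\<close>
lemma (in prob_space) gaussian_pair_law:
  fixes U V :: "'a \<Rightarrow> real"
  assumes [measurable]: "U \<in> borel_measurable M" "V \<in> borel_measurable M"
    and char: "\<And>a b. (CLINT \<omega>|M. iexp (a * U \<omega> + b * V \<omega>))
                  = complex_of_real (exp (- (a\<^sup>2 + b\<^sup>2) / 2))"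
  shows "distr M (borel \<Otimes>\<^sub>M borel) (\<lambda>\<omega>. (U \<omega>, V \<omega>))
           = std_normal_distribution \<Otimes>\<^sub>M std_normal_distribution"
proof -
  let ?n = "std_normal_distribution"
  have int: "integrable M (\<lambda>\<omega>. iexp (a * U \<omega> + b * V \<omega>))" for a b
    by (intro integrable_iexp) auto
  have trig_bounds: "0 \<le> 1 + cos x" "1 + cos x \<le> 2" "0 \<le> 1 + sin x" "1 + sin x \<le> 2" for x :: real
    using cos_ge_minus_one[of x] cos_le_one[of x] sin_ge_minus_one[of x] sin_le_one[of x] by linarith+
  have V: "prob {\<omega>\<in>space M. V \<omega> \<in> B} = measure ?n B" if B[measurable]: "B \<in> sets borel" for B
  proof -
    have "(LINT \<omega>|M. 1 * indicator B (V \<omega>) :: real) = 1 * measure ?n B"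
      by (rule gaussian_char_weighted[where B=1]) (use char[of 0] in auto)
    also have "(LINT \<omega>|M. 1 * indicator B (V \<omega>) :: real) = (LINT \<omega>|M. indicator {\<omega>\<in>space M. V \<omega> \<in> B} \<omega>)"
      by (intro Bochner_Integration.integral_cong) (auto split: split_indicator)
    finally show ?thesis by simp
  qed
  \<comment> \<open>The weight has to be nonnegative, so cosine and sine are shifted up by one.\<close>
  have cosV: "(LINT \<omega>|M. (1 + cos (a * U \<omega>)) * indicator B (V \<omega>)) = (1 + exp (- a\<^sup>2 / 2)) * measure ?n B"
    if B[measurable]: "B \<in> sets borel" for a B
  proof (rule gaussian_char_weighted[where B=2])
    fix b
    have e: "(1 + cos (a * U \<omega>)) * iexp (b * V \<omega>) = iexp (0 * U \<omega> + b * V \<omega>)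
          + (iexp (a * U \<omega> + b * V \<omega>) + iexp ((-a) * U \<omega> + b * V \<omega>)) / 2" for \<omega>
      by (auto simp: complex_eq_iff Re_exp Im_exp cos_add sin_add cos_diff sin_diff field_simps)
    show "(CLINT \<omega>|M. complex_of_real (1 + cos (a * U \<omega>)) * iexp (b * V \<omega>))
            = complex_of_real ((1 + exp (- a\<^sup>2 / 2)) * exp (- b\<^sup>2 / 2))"
      unfolding e
      apply (subst Bochner_Integration.integral_add)
        apply (rule int)
       apply (intro integrable_divide_zero Bochner_Integration.integrable_add int impI)
      apply (subst integral_divide_zero)
      apply (subst Bochner_Integration.integral_add[OF int int])
      apply (simp only: char)
      apply (simp add: field_simps flip: exp_add of_real_add of_real_mult of_real_divide)
      apply simp
      done
  qed (use trig_bounds in auto)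
  have sinV: "(LINT \<omega>|M. (1 + sin (a * U \<omega>)) * indicator B (V \<omega>)) = 1 * measure ?n B"
    if B[measurable]: "B \<in> sets borel" for a B
  proof (rule gaussian_char_weighted[where B=2])
    fix b
    have e: "(1 + sin (a * U \<omega>)) * iexp (b * V \<omega>) = iexp (0 * U \<omega> + b * V \<omega>)
          + (iexp (a * U \<omega> + b * V \<omega>) - iexp ((-a) * U \<omega> + b * V \<omega>)) / (2 * \<i>)" for \<omega>
      by (auto simp: complex_eq_iff Re_exp Im_exp cos_add sin_add cos_diff sin_diff field_simps Re_divide Im_divide)
    show "(CLINT \<omega>|M. complex_of_real (1 + sin (a * U \<omega>)) * iexp (b * V \<omega>))
            = complex_of_real (1 * exp (- b\<^sup>2 / 2))"
      unfolding e
      apply (subst Bochner_Integration.integral_add)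
        apply (rule int)
       apply (intro integrable_divide_zero Bochner_Integration.integrable_diff int impI)
      apply (subst integral_divide_zero)
      apply (subst Bochner_Integration.integral_diff[OF int int])
      apply (simp only: char)
      apply (simp add: field_simps flip: exp_add of_real_add of_real_mult of_real_divide)
      done
  qed (use trig_bounds in auto)
  have UV: "prob {\<omega>\<in>space M. U \<omega> \<in> A \<and> V \<omega> \<in> B} = measure ?n A * measure ?n B"
    if A[measurable]: "A \<in> sets borel" and B[measurable]: "B \<in> sets borel" for A B
  proof -
    have i: "integrable M (\<lambda>\<omega>. f (a * U \<omega>) * indicator B (V \<omega>))"
      if [measurable]: "f \<in> borel_measurable borel" and "\<And>x. \<bar>f x\<bar> \<le> 1" for f :: "real \<Rightarrow> real" and a
      by (intro integrable_const_bound[where B=1]) (use that in \<open>auto split: split_indicator\<close>)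
    have i1: "integrable M (\<lambda>\<omega>. indicator B (V \<omega>) :: real)"
      using i[of "\<lambda>_. 1"] by simp
    have m: "(LINT \<omega>|M. indicator B (V \<omega>) :: real) = measure ?n B"
    proof -
      have "(LINT \<omega>|M. indicator B (V \<omega>) :: real) = (LINT \<omega>|M. indicator {\<omega>\<in>space M. V \<omega> \<in> B} \<omega>)"
        by (intro Bochner_Integration.integral_cong) (auto split: split_indicator)
      then show ?thesis using V[OF B] by simp
    qed
    have c: "(LINT \<omega>|M. cos (a * U \<omega>) * indicator B (V \<omega>)) = exp (- a\<^sup>2 / 2) * measure ?n B" for a
      using cosV[OF B, of a] m i[of cos a] i1
      by (simp add: distrib_right)
    have s: "(LINT \<omega>|M. sin (a * U \<omega>) * indicator B (V \<omega>)) = 0" for a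
      using sinV[OF B, of a] m i[of sin a] i1
      by (simp add: distrib_right)
    have "(LINT \<omega>|M. indicator B (V \<omega>) * indicator A (U \<omega>) :: real) = measure ?n B * measure ?n A"
    proof (rule gaussian_char_weighted[where B=1])
      fix a
      have e: "complex_of_real (indicator B (V \<omega>)) * iexp (a * U \<omega>)
        = complex_of_real (cos (a * U \<omega>) * indicator B (V \<omega>)) + \<i> * complex_of_real (sin (a * U \<omega>) * indicator B (V \<omega>))" for \<omega>
        by (auto simp: complex_eq_iff Re_exp Im_exp)
      show "(CLINT \<omega>|M. complex_of_real (indicator B (V \<omega>)) * iexp (a * U \<omega>))
              = complex_of_real (measure ?n B * exp (- a\<^sup>2 / 2))"
        unfolding e
        apply (subst Bochner_Integration.integral_add)
        apply (rule integrable_of_real[OF i]; simp)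
        apply (intro integrable_mult_right integrable_of_real i; simp)
        apply (subst integral_mult_right_zero)
        apply (simp only: integral_complex_of_real c s)
        apply simp
        done
    qed auto
    moreover have "(LINT \<omega>|M. indicator B (V \<omega>) * indicator A (U \<omega>) :: real)
        = (LINT \<omega>|M. indicator {\<omega>\<in>space M. U \<omega> \<in> A \<and> V \<omega> \<in> B} \<omega>)"
      by (intro Bochner_Integration.integral_cong) (auto split: split_indicator)
    ultimately show ?thesis by simp
  qed
  interpret n: prob_space ?n
    using real_dist_normal_dist real_distribution_def by blast
  show ?thesis
  proof (rule pair_measure_eqI[symmetric])
    show "sets (?n \<Otimes>\<^sub>M ?n) = sets (distr M (borel \<Otimes>\<^sub>M borel) (\<lambda>\<omega>. (U \<omega>, V \<omega>)))"
      by (simp cong: sets_pair_measure_cong)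
    fix A B assume "A \<in> sets ?n" "B \<in> sets ?n"
    then have AB: "A \<in> sets borel" "B \<in> sets borel" by auto
    have "emeasure (distr M (borel \<Otimes>\<^sub>M borel) (\<lambda>\<omega>. (U \<omega>, V \<omega>))) (A \<times> B)
        = emeasure M ((\<lambda>\<omega>. (U \<omega>, V \<omega>)) -` (A \<times> B) \<inter> space M)"
      using AB by (subst emeasure_distr) auto
    also have "(\<lambda>\<omega>. (U \<omega>, V \<omega>)) -` (A \<times> B) \<inter> space M = {\<omega>\<in>space M. U \<omega> \<in> A \<and> V \<omega> \<in> B}"
      by auto
    also have "emeasure M \<dots> = emeasure ?n A * emeasure ?n B"
      using UV[OF AB] by (simp add: emeasure_eq_measure n.emeasure_eq_measure ennreal_mult)
    finally show "emeasure ?n A * emeasure ?n B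
        = emeasure (distr M (borel \<Otimes>\<^sub>M borel) (\<lambda>\<omega>. (U \<omega>, V \<omega>))) (A \<times> B)" by simp
  qed (auto intro: n.sigma_finite_measure_axioms)
qed

section \<open>Estimates for normal densities\<close>

text \<open>Writes an inverse square root, including its value \<open>\<infinity>\<close> at zero, as a mixture of the
  exponentials that occur in Gaussian characteristic functions.\<close>
lemma nn_integral_gaussian_kernel:
  assumes "v \<ge> 0"
  shows "(\<integral>\<^sup>+\<xi>. ennreal (exp (- (\<xi>\<^sup>2 * v))) \<partial>lborel) = ennreal (sqrt pi) * inverse (ennreal (sqrt v))"
proof (cases "v = 0")
  case False
  with assms have v: "v > 0" by simp
  let ?s = "1 / sqrt (2 * v)"
  have e: "exp (- (\<xi>\<^sup>2 * v)) = sqrt (pi / v) * normal_density 0 ?s \<xi>" for \<xi>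
    using v by (simp add: normal_density_def power_divide real_sqrt_mult real_sqrt_divide field_simps)
  have "(\<integral>\<^sup>+\<xi>. ennreal (exp (- (\<xi>\<^sup>2 * v))) \<partial>lborel)
      = ennreal (LINT \<xi>|lborel. sqrt (pi / v) * normal_density 0 ?s \<xi>)"
    unfolding e using v by (intro nn_integral_eq_integral) auto
  also have "\<dots> = ennreal (sqrt pi / sqrt v)"
    using v by (simp add: real_sqrt_divide)
  finally show ?thesis
    using v by (simp add: divide_inverse ennreal_mult inverse_ennreal)
qed (simp add: ennreal_mult_top)

text \<open>One of the factors of \<open>1 - r\<^sup>2 = (1 - r) (1 + r)\<close> is at least \<open>1\<close>, so the product is at
  least the other one.\<close>
lemma inverse_sqrt_one_minus_square_le:
  fixes r :: real
  assumes "\<bar>r\<bar> \<le> 1"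
  shows "inverse (ennreal (sqrt (1 - r\<^sup>2)))
    \<le> 2 * (inverse (ennreal (sqrt (2 - 2 * r))) + inverse (ennreal (sqrt (2 + 2 * r))))"
proof -
  have *: "inverse (ennreal k) \<le> 2 * inverse (ennreal a)" if "0 \<le> a" "0 \<le> k" "a \<le> 2 * k" for a k
  proof (cases "a = 0")
    case False
    with that have "a > 0" "k > 0" by auto
    moreover have "inverse k \<le> 2 * inverse a"
      using that \<open>a > 0\<close> \<open>k > 0\<close> by (simp add: field_simps)
    ultimately show ?thesis
      by (metis ennreal_leI ennreal_mult' ennreal_numeral inverse_ennreal zero_le_numeral)
  qed (simp add: ennreal_mult_top)
  have r: "-1 \<le> r" "r \<le> 1" using assms by auto
  have nn: "1 - r\<^sup>2 \<ge> 0" using assms by (simp add: abs_square_le_1)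
  have sq: "sqrt x \<le> 2 * sqrt (1 - r\<^sup>2)" if "x \<le> 4 * (1 - r\<^sup>2)" for x
    using real_sqrt_le_mono[OF that] by (simp only: real_sqrt_mult real_sqrt_four)
  show ?thesis
  proof (cases "r \<ge> 0")
    case True
    have "r * r \<le> r * 1" using True r by (intro mult_left_mono) auto
    then have "sqrt (2 - 2 * r) \<le> 2 * sqrt (1 - r\<^sup>2)"
      using r by (intro sq) (simp add: power2_eq_square)
    from *[OF _ _ this] show ?thesis
      using r nn by (simp add: distrib_left) (metis add_increasing2 zero_le)
  next
    case False
    have "(-r) * (-r) \<le> (-r) * 1" using False r by (intro mult_left_mono) auto
    then have "sqrt (2 + 2 * r) \<le> 2 * sqrt (1 - r\<^sup>2)"
      using r by (intro sq) (simp add: power2_eq_square)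
    from *[OF _ _ this] show ?thesis
      using r nn by (simp add: distrib_left) (metis add_increasing zero_le)
  qed
qed

lemma mult_exp_neg_half_square_le: "\<bar>z\<bar> * exp (- z\<^sup>2 / 2) \<le> (1::real)"
proof -
  have "\<bar>z\<bar> \<le> 1 + z\<^sup>2 / 2"
    using zero_le_power2[of "\<bar>z\<bar> - 1"] by (simp add: power2_diff)
  also have "\<dots> \<le> exp (z\<^sup>2 / 2)" by (rule exp_ge_add_one_self)
  finally show ?thesis by (simp add: exp_minus field_simps)
qed

lemma normal_density_le:
  assumes "\<sigma> > 0"
  shows "normal_density \<mu> \<sigma> y \<le> 1 / \<sigma>"
proof -
  have "1 * \<sigma> \<le> sqrt (2 * pi) * \<sigma>"
    using assms pi_gt3 by (intro mult_right_mono) auto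
  then have "1 / sqrt (2 * pi * \<sigma>\<^sup>2) \<le> 1 / \<sigma>"
    using assms by (simp add: real_sqrt_mult frac_le)
  moreover have "exp (- (y - \<mu>)\<^sup>2 / (2 * \<sigma>\<^sup>2)) \<le> 1" by simp
  ultimately have "normal_density \<mu> \<sigma> y \<le> (1 / \<sigma>) * 1"
    unfolding normal_density_def using assms by (intro mult_mono) auto
  then show ?thesis by simp
qed

lemma normal_density_Lipschitz:
  assumes "\<sigma> > 0"
  shows "\<bar>normal_density \<mu> \<sigma> y - normal_density \<mu> \<sigma> c\<bar> \<le> \<bar>y - c\<bar> / \<sigma>\<^sup>2"
proof -
  have "norm (normal_density \<mu> \<sigma> y - normal_density \<mu> \<sigma> c) \<le> (1 / \<sigma>\<^sup>2) * norm (y - c)"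
  proof (rule field_differentiable_bound[where S=UNIV])
    fix x :: real
    show "(normal_density \<mu> \<sigma> has_field_derivative (- (x - \<mu>) / \<sigma>\<^sup>2 * normal_density \<mu> \<sigma> x)) (at x within UNIV)"
      unfolding normal_density_def
      by (rule derivative_eq_intros refl | use assms in \<open>simp add: field_simps\<close>)+
    let ?z = "(x - \<mu>) / \<sigma>"
    have "norm (- (x - \<mu>) / \<sigma>\<^sup>2 * normal_density \<mu> \<sigma> x)
        = (1 / sqrt (2 * pi)) * ((1 / \<sigma>\<^sup>2) * (\<bar>?z\<bar> * exp (- ?z\<^sup>2 / 2)))"
      using assms
      by (simp add: normal_density_def abs_mult real_sqrt_mult power_divide power2_eq_square mult_ac abs_minus_commute)
    also have "\<dots> \<le> 1 * ((1 / \<sigma>\<^sup>2) * 1)"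
      using assms pi_gt3 mult_exp_neg_half_square_le[of ?z]
      by (intro mult_mono) auto
    finally show "norm (- (x - \<mu>) / \<sigma>\<^sup>2 * normal_density \<mu> \<sigma> x) \<le> 1 / \<sigma>\<^sup>2" by simp
  qed auto
  then show ?thesis by simp
qed

text \<open>As \<open>h\<close> has integral zero, the normal density can be replaced by its difference to the value at
  \<open>c\<close>. On the support of \<open>h\<close> this difference is at most \<open>1/\<sigma>\<close>, because the density takes values
  between zero and that, and at most \<open>r/\<sigma>\<^sup>2\<close> by the Lipschitz bound.\<close>
lemma normal_average_small:
  assumes \<sigma>: "\<sigma> > 0" and h: "integrable lborel h" and h0: "(LINT y|lborel. h y) = 0"
    and h2: "(LINT y|lborel. \<bar>h y\<bar>) \<le> 2" and supp: "\<And>y. \<bar>y - c\<bar> > r \<Longrightarrow> h y = 0" and r: "r \<ge> 0"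
  shows "\<bar>LINT v|std_normal_distribution. h (\<mu> + \<sigma> * v)\<bar> \<le> 2 * min (1 / \<sigma>) (r / \<sigma>\<^sup>2)"
proof -
  have [measurable]: "h \<in> borel_measurable borel" using h by auto
  let ?p = "normal_density \<mu> \<sigma>" and ?K = "min (1 / \<sigma>) (r / \<sigma>\<^sup>2)"
  have "(LINT v|std_normal_distribution. h (\<mu> + \<sigma> * v)) = (LINT v|lborel. std_normal_density v * h (\<mu> + \<sigma> * v))"
    by (subst integral_density) auto
  also have "\<dots> = (LINT v|lborel. \<sigma> * (?p (\<mu> + \<sigma> * v) * h (\<mu> + \<sigma> * v)))"
    using \<sigma> by (simp add: normal_density_def real_sqrt_mult power_mult_distrib)
  also have "\<dots> = (LINT y|lborel. ?p y * h y)"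
    using \<sigma> lborel_integral_real_affine[of \<sigma> "\<lambda>y. ?p y * h y" \<mu>] by simp
  finally have eq: "(LINT v|std_normal_distribution. h (\<mu> + \<sigma> * v)) = (LINT y|lborel. ?p y * h y)" .
  have bd: "\<bar>(?p y - ?p c) * h y\<bar> \<le> ?K * \<bar>h y\<bar>" for y
  proof (cases "\<bar>y - c\<bar> > r")
    case False
    have "\<bar>?p y - ?p c\<bar> \<le> 1 / \<sigma>"
      using normal_density_le[OF \<sigma>, of \<mu> y] normal_density_le[OF \<sigma>, of \<mu> c]
        normal_density_nonneg[of \<mu> \<sigma> y] normal_density_nonneg[of \<mu> \<sigma> c] unfolding abs_le_iff by linarith
    moreover have "\<bar>?p y - ?p c\<bar> \<le> r / \<sigma>\<^sup>2"
      using normal_density_Lipschitz[OF \<sigma>, of \<mu> y c] False \<sigma>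
      by (meson divide_right_mono not_less order_trans zero_le_power2)
    ultimately show ?thesis
      unfolding abs_mult by (intro mult_right_mono) auto
  qed (simp add: supp)
  have ph: "integrable lborel (\<lambda>y. ?p y * h y)"
  proof (rule Bochner_Integration.integrable_bound)
    show "integrable lborel (\<lambda>y. (1 / \<sigma>) * h y)" using h by simp
    show "AE y in lborel. norm (?p y * h y) \<le> norm ((1 / \<sigma>) * h y)"
      using normal_density_le[OF \<sigma>, of \<mu>] \<sigma>
      by (intro AE_I2) (simp add: abs_mult mult_right_mono del: times_divide_eq_left)
  qed simp
  have "(LINT y|lborel. ?p y * h y) = (LINT y|lborel. ?p y * h y - ?p c * h y)"
    using ph h h0 by simp
  also have "\<dots> = (LINT y|lborel. (?p y - ?p c) * h y)" by (simp add: left_diff_distrib)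
  also have "\<bar>\<dots>\<bar> \<le> (LINT y|lborel. ?K * \<bar>h y\<bar>)"
    using Bochner_Integration.integral_norm_bound_integral[of lborel "\<lambda>y. (?p y - ?p c) * h y" "\<lambda>y. ?K * \<bar>h y\<bar>"] bd h ph
    by (simp add: left_diff_distrib)
  also have "\<dots> \<le> ?K * 2"
    using h2 \<sigma> r by (simp add: mult_left_mono del: min_less_iff_conj)
  finally show ?thesis using eq by simp
qed

section \<open>Correlations of a Gaussian process of unit variance\<close>

definition corr :: "'w measure \<Rightarrow> ('t \<Rightarrow> 'w \<Rightarrow> real) \<Rightarrow> 't \<Rightarrow> 't \<Rightarrow> real" where
  "corr M W s t = (LINT \<omega>|M. W s \<omega> * W t \<omega>)"

text \<open>Gaussianity is stated for pairs of times, by characteristic functions: this form covers perfectly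
  correlated pairs, which have no joint density. Taking \<open>b = 0\<close> shows that each \<open>W s\<close> is standard
  normal. The function \<open>m\<close> is the mean of the process \<open>Z\<close> of interest.\<close>
locale unit_gaussian_process = prob_space M + N: finite_measure N
  for M :: "'w measure" and N :: "'t measure" +
  fixes W :: "'t \<Rightarrow> 'w \<Rightarrow> real" and m :: "'t \<Rightarrow> real"
  assumes W_joint: "(\<lambda>(t, \<omega>). W t \<omega>) \<in> borel_measurable (N \<Otimes>\<^sub>M M)"
    and m_measurable [measurable]: "m \<in> borel_measurable N"
    and char: "\<And>s t a b. s \<in> space N \<Longrightarrow> t \<in> space N \<Longrightarrow>
      (CLINT \<omega>|M. iexp (a * W s \<omega> + b * W t \<omega>))
        = complex_of_real (exp (- (a\<^sup>2 + 2 * a * b * corr M W s t + b\<^sup>2) / 2))"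
    and energy: "(\<integral>\<^sup>+s. (\<integral>\<^sup>+t. inverse (ennreal (sqrt (2 - 2 * corr M W s t))) \<partial>N) \<partial>N) < \<infinity>"
begin

sublocale NN: pair_sigma_finite N N ..
sublocale NN: finite_measure "N \<Otimes>\<^sub>M N"
  by (rule finite_measure_pair_measure) unfold_locales
sublocale NNM: pair_sigma_finite "N \<Otimes>\<^sub>M N" M ..
sublocale NNR: pair_sigma_finite "N \<Otimes>\<^sub>M N" "lborel :: real measure" ..

definition Z :: "'t \<Rightarrow> 'w \<Rightarrow> real" where "Z t \<omega> = m t + W t \<omega>"

text \<open>The standard deviation of \<open>Z t\<close> given \<open>Z s\<close>, for \<open>p = (s, t)\<close>.\<close>
definition kappa :: "'t \<times> 't \<Rightarrow> real" where
  "kappa p = sqrt (1 - (corr M W (fst p) (snd p))\<^sup>2)"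

lemma W_measurable [measurable (raw)]:
  assumes "f \<in> measurable K N" "g \<in> measurable K M"
  shows "(\<lambda>x. W (f x) (g x)) \<in> borel_measurable K"
  using measurable_compose[OF measurable_Pair[OF assms] W_joint] by simp

lemma Z_measurable [measurable (raw)]:
  assumes "f \<in> measurable K N" "g \<in> measurable K M"
  shows "(\<lambda>x. Z (f x) (g x)) \<in> borel_measurable K"
  unfolding Z_def using assms by measurable

lemma corr_measurable [measurable]: "(\<lambda>p. corr M W (fst p) (snd p)) \<in> borel_measurable (N \<Otimes>\<^sub>M N)"
  unfolding corr_def by measurable

lemma kappa_measurable [measurable]: "kappa \<in> borel_measurable (N \<Otimes>\<^sub>M N)"
  unfolding kappa_def by measurable

lemma corr_bound:
  assumes "s \<in> space N" "t \<in> space N"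
  shows "\<bar>corr M W s t\<bar> \<le> 1"
proof -
  have *: "- (a\<^sup>2 + 2 * a * b * corr M W s t + b\<^sup>2) \<le> 0" for a b
  proof -
    have "norm (CLINT \<omega>|M. iexp (a * W s \<omega> + b * W t \<omega>)) \<le> (LINT \<omega>|M. norm (iexp (a * W s \<omega> + b * W t \<omega>)))"
      by (rule integral_norm_bound)
    also have "\<dots> = 1"
      unfolding norm_exp_i_times by (simp add: prob_space)
    finally show ?thesis unfolding char[OF assms] by simp
  qed
  show ?thesis
    using *[of 1 1] *[of 1 "-1"] by (simp add: abs_le_iff)
qed

lemma expectation_cos:
  assumes [simp]: "s \<in> space N" "t \<in> space N"
  shows "(LINT \<omega>|M. cos (a * W s \<omega> + b * W t \<omega>))
    = exp (- (a\<^sup>2 + 2 * a * b * corr M W s t + b\<^sup>2) / 2)"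
proof -
  have int: "integrable M (\<lambda>\<omega>. iexp (a * W s \<omega> + b * W t \<omega>))"
    by (intro integrable_iexp) auto
  have "(LINT \<omega>|M. cos (a * W s \<omega> + b * W t \<omega>)) = (LINT \<omega>|M. Re (iexp (a * W s \<omega> + b * W t \<omega>)))"
    by (simp add: Re_exp)
  also have "\<dots> = Re (CLINT \<omega>|M. iexp (a * W s \<omega> + b * W t \<omega>))"
    using int by (rule integral_Re)
  finally show ?thesis
    by (simp only: char[OF assms] Re_complex_of_real)
qed

lemma second_moment_time_integral:
  fixes K :: "'t \<Rightarrow> 'w \<Rightarrow> real"
  assumes [measurable]: "(\<lambda>x. K (fst x) (snd x)) \<in> borel_measurable (N \<Otimes>\<^sub>M M)"
    and B: "\<And>t \<omega>. \<bar>K t \<omega>\<bar> \<le> B"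
  shows "(LINT \<omega>|M. (LINT t|N. K t \<omega>)\<^sup>2) = (LINT p|(N \<Otimes>\<^sub>M N). (LINT \<omega>|M. K (fst p) \<omega> * K (snd p) \<omega>))"
    and "integrable (N \<Otimes>\<^sub>M N) (\<lambda>p. LINT \<omega>|M. K (fst p) \<omega> * K (snd p) \<omega>)"
proof -
  have Km [measurable (raw)]: "(\<lambda>x. K (f x) (g x)) \<in> borel_measurable L"
    if "f \<in> measurable L N" "g \<in> measurable L M" for f g and L :: "'z measure"
    using measurable_compose[OF measurable_Pair[OF that] assms(1)] by simp
  have Kb: "\<bar>K s \<omega> * K t \<omega>\<bar> \<le> B * B" for s t \<omega>
    unfolding abs_mult by (intro mult_mono B order_trans[OF abs_ge_zero B]) auto
  interpret T: finite_measure "(N \<Otimes>\<^sub>M N) \<Otimes>\<^sub>M M"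
    by (rule finite_measure_pair_measure) unfold_locales
  have int: "integrable ((N \<Otimes>\<^sub>M N) \<Otimes>\<^sub>M M) (\<lambda>(p, \<omega>). K (fst p) \<omega> * K (snd p) \<omega>)"
    by (intro T.integrable_const_bound[where B="B * B"]) (use Kb in \<open>auto simp: split_beta'\<close>)
  have "(LINT t|N. K t \<omega>)\<^sup>2 = (LINT p|(N \<Otimes>\<^sub>M N). K (fst p) \<omega> * K (snd p) \<omega>)" if "\<omega> \<in> space M" for \<omega>
  proof -
    have "integrable (N \<Otimes>\<^sub>M N) (\<lambda>p. K (fst p) \<omega> * K (snd p) \<omega>)"
      by (intro NN.integrable_const_bound[where B="B * B"]) (use Kb that in auto)
    from NN.integral_fst'[OF this] show ?thesis by (simp add: power2_eq_square)
  qed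
  then have "(LINT \<omega>|M. (LINT t|N. K t \<omega>)\<^sup>2) = (LINT \<omega>|M. (LINT p|(N \<Otimes>\<^sub>M N). K (fst p) \<omega> * K (snd p) \<omega>))"
    by (intro Bochner_Integration.integral_cong) auto
  also have "\<dots> = (LINT p|(N \<Otimes>\<^sub>M N). (LINT \<omega>|M. K (fst p) \<omega> * K (snd p) \<omega>))"
    by (rule NNM.Fubini_integral[OF int])
  finally show "(LINT \<omega>|M. (LINT t|N. K t \<omega>)\<^sup>2) = (LINT p|(N \<Otimes>\<^sub>M N). (LINT \<omega>|M. K (fst p) \<omega> * K (snd p) \<omega>))" .
  show "integrable (N \<Otimes>\<^sub>M N) (\<lambda>p. LINT \<omega>|M. K (fst p) \<omega> * K (snd p) \<omega>)"
    using NNM.integrable_fst[OF int] by simp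
qed

text \<open>Positive definiteness in a form that characteristic functions can reach: the second moment of
  \<open>\<integral> sin (\<surd>2 y W\<^sub>t) dt\<close> is nonnegative, and
  \<open>E sin (\<surd>2 y W\<^sub>s) sin (\<surd>2 y W\<^sub>t)\<close> is half the difference of the two exponentials.\<close>
lemma exp_corr_reflection:
  "(\<integral>\<^sup>+p. ennreal (exp (- (y\<^sup>2 * (2 + 2 * corr M W (fst p) (snd p))))) \<partial>(N \<Otimes>\<^sub>M N))
    \<le> (\<integral>\<^sup>+p. ennreal (exp (- (y\<^sup>2 * (2 - 2 * corr M W (fst p) (snd p))))) \<partial>(N \<Otimes>\<^sub>M N))"
proof -
  let ?P = "N \<Otimes>\<^sub>M N" and ?r = "\<lambda>p. corr M W (fst p) (snd p)"
  let ?z = "sqrt 2 * y"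
  have bd: "0 \<le> 2 + 2 * ?r p" "0 \<le> 2 - 2 * ?r p" if "p \<in> space ?P" for p
    using corr_bound[of "fst p" "snd p"] that by (auto simp: space_pair_measure)
  have i1: "integrable ?P (\<lambda>p. exp (- (y\<^sup>2 * (2 + 2 * ?r p))))"
    using bd by (intro NN.integrable_const_bound[where B=1]) auto
  have i2: "integrable ?P (\<lambda>p. exp (- (y\<^sup>2 * (2 - 2 * ?r p))))"
    using bd by (intro NN.integrable_const_bound[where B=1]) auto
  have "0 \<le> (LINT \<omega>|M. (LINT t|N. sin (?z * W t \<omega>))\<^sup>2)"
    by simp
  also have "\<dots> = (LINT p|?P. (LINT \<omega>|M. sin (?z * W (fst p) \<omega>) * sin (?z * W (snd p) \<omega>)))"
    by (rule second_moment_time_integral[where B=1]) auto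
  also have "\<dots> = (LINT p|?P. (exp (- (y\<^sup>2 * (2 - 2 * ?r p))) - exp (- (y\<^sup>2 * (2 + 2 * ?r p)))) / 2)"
  proof (intro Bochner_Integration.integral_cong refl)
    fix p assume "p \<in> space ?P"
    then have st [simp]: "fst p \<in> space N" "snd p \<in> space N"
      by (auto simp: space_pair_measure)
    have c: "integrable M (\<lambda>\<omega>. cos (a * W (fst p) \<omega> + b * W (snd p) \<omega>))" for a b
      by (intro integrable_const_bound[where B=1]) auto
    have "(LINT \<omega>|M. sin (?z * W (fst p) \<omega>) * sin (?z * W (snd p) \<omega>))
      = (LINT \<omega>|M. (cos (?z * W (fst p) \<omega> + (- ?z) * W (snd p) \<omega>) - cos (?z * W (fst p) \<omega> + ?z * W (snd p) \<omega>)) / 2)"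
      by (simp add: sin_times_sin)
    also have "\<dots> = (exp (- (?z\<^sup>2 + 2 * ?z * (- ?z) * ?r p + (- ?z)\<^sup>2) / 2)
         - exp (- (?z\<^sup>2 + 2 * ?z * ?z * ?r p + ?z\<^sup>2) / 2)) / 2"
      by (simp only: integral_divide_zero Bochner_Integration.integral_diff[OF c c] expectation_cos[OF st])
    also have "\<dots> = (exp (- (y\<^sup>2 * (2 - 2 * ?r p))) - exp (- (y\<^sup>2 * (2 + 2 * ?r p)))) / 2"
    proof -
      have 1: "- (?z\<^sup>2 + 2 * ?z * (- ?z) * ?r p + (- ?z)\<^sup>2) / 2 = - (y\<^sup>2 * (2 - 2 * ?r p))"
        by (simp add: power2_eq_square field_simps)
      have 2: "- (?z\<^sup>2 + 2 * ?z * ?z * ?r p + ?z\<^sup>2) / 2 = - (y\<^sup>2 * (2 + 2 * ?r p))"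
        by (simp add: power2_eq_square field_simps)
      show ?thesis
        unfolding 1 2 ..
    qed
    finally show "(LINT \<omega>|M. sin (?z * W (fst p) \<omega>) * sin (?z * W (snd p) \<omega>)) = \<dots>" .
  qed
  also have "\<dots> = ((LINT p|?P. exp (- (y\<^sup>2 * (2 - 2 * ?r p)))) - (LINT p|?P. exp (- (y\<^sup>2 * (2 + 2 * ?r p))))) / 2"
    using i1 i2 by simp
  finally have "(LINT p|?P. exp (- (y\<^sup>2 * (2 + 2 * ?r p)))) \<le> (LINT p|?P. exp (- (y\<^sup>2 * (2 - 2 * ?r p))))"
    by simp
  then show ?thesis
    by (simp add: nn_integral_eq_integral[OF i1] nn_integral_eq_integral[OF i2] ennreal_leI)
qed

lemma energy_pair:
  "(\<integral>\<^sup>+p. inverse (ennreal (sqrt (2 - 2 * corr M W (fst p) (snd p)))) \<partial>(N \<Otimes>\<^sub>M N)) < \<infinity>"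
  using energy N.nn_integral_fst[of "\<lambda>p. inverse (ennreal (sqrt (2 - 2 * corr M W (fst p) (snd p))))" N]
  by simp

text \<open>By \<open>nn_integral_gaussian_kernel\<close>, both sides are, up to the factor \<open>\<surd>\<pi>\<close>, integrals over \<open>y\<close> of
  the corresponding sides of \<open>exp_corr_reflection\<close>. So the energy condition, which by itself only
  controls correlations near \<open>1\<close>, controls those near \<open>-1\<close> too.\<close>
lemma energy_reflection:
  "(\<integral>\<^sup>+p. inverse (ennreal (sqrt (2 + 2 * corr M W (fst p) (snd p)))) \<partial>(N \<Otimes>\<^sub>M N))
    \<le> (\<integral>\<^sup>+p. inverse (ennreal (sqrt (2 - 2 * corr M W (fst p) (snd p)))) \<partial>(N \<Otimes>\<^sub>M N))"
proof -
  let ?P = "N \<Otimes>\<^sub>M N" and ?r = "\<lambda>p. corr M W (fst p) (snd p)"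
  have eq: "ennreal (sqrt pi) * (\<integral>\<^sup>+p. inverse (ennreal (sqrt (v p))) \<partial>?P)
      = (\<integral>\<^sup>+y. (\<integral>\<^sup>+p. ennreal (exp (- (y\<^sup>2 * v p))) \<partial>?P) \<partial>lborel)"
    if [measurable]: "v \<in> borel_measurable ?P" and v: "\<And>p. p \<in> space ?P \<Longrightarrow> 0 \<le> v p" for v
  proof -
    have "ennreal (sqrt pi) * (\<integral>\<^sup>+p. inverse (ennreal (sqrt (v p))) \<partial>?P)
        = (\<integral>\<^sup>+p. (\<integral>\<^sup>+y. ennreal (exp (- (y\<^sup>2 * v p))) \<partial>lborel) \<partial>?P)"
      using v by (simp add: nn_integral_gaussian_kernel nn_integral_cmult[symmetric] cong: nn_integral_cong)
    also have "\<dots> = (\<integral>\<^sup>+y. (\<integral>\<^sup>+p. ennreal (exp (- (y\<^sup>2 * v p))) \<partial>?P) \<partial>lborel)"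
      by (intro NNR.Fubini'[symmetric]) simp
    finally show ?thesis .
  qed
  have bd: "0 \<le> 2 + 2 * ?r p" "0 \<le> 2 - 2 * ?r p" if "p \<in> space ?P" for p
    using corr_bound[of "fst p" "snd p"] that by (auto simp: space_pair_measure)
  have "ennreal (sqrt pi) * (\<integral>\<^sup>+p. inverse (ennreal (sqrt (2 + 2 * ?r p))) \<partial>?P)
      \<le> ennreal (sqrt pi) * (\<integral>\<^sup>+p. inverse (ennreal (sqrt (2 - 2 * ?r p))) \<partial>?P)"
    using bd by (subst (1 2) eq) (auto intro!: nn_integral_mono exp_corr_reflection)
  then show ?thesis
    by (subst (asm) ennreal_mult_le_mult_iff) auto
qed

lemma energy_kappa: "(\<integral>\<^sup>+p. inverse (ennreal (kappa p)) \<partial>(N \<Otimes>\<^sub>M N)) < \<infinity>"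
proof -
  let ?P = "N \<Otimes>\<^sub>M N" and ?r = "\<lambda>p. corr M W (fst p) (snd p)"
  have "(\<integral>\<^sup>+p. inverse (ennreal (kappa p)) \<partial>?P)
    \<le> (\<integral>\<^sup>+p. 2 * (inverse (ennreal (sqrt (2 - 2 * ?r p))) + inverse (ennreal (sqrt (2 + 2 * ?r p)))) \<partial>?P)"
    using corr_bound unfolding kappa_def
    by (intro nn_integral_mono inverse_sqrt_one_minus_square_le) (auto simp: space_pair_measure)
  also have "\<dots> = 2 * ((\<integral>\<^sup>+p. inverse (ennreal (sqrt (2 - 2 * ?r p))) \<partial>?P) + (\<integral>\<^sup>+p. inverse (ennreal (sqrt (2 + 2 * ?r p))) \<partial>?P))"
    by (simp add: nn_integral_cmult nn_integral_add)
  also have "\<dots> < \<infinity>"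
    using energy_pair le_less_trans[OF energy_reflection energy_pair]
    by (simp add: ennreal_mult_less_top)
  finally show ?thesis .
qed

lemma kappa_nonneg: "p \<in> space (N \<Otimes>\<^sub>M N) \<Longrightarrow> kappa p \<ge> 0"
  using corr_bound[of "fst p" "snd p"] unfolding kappa_def
  by (auto simp: space_pair_measure abs_square_le_1)

lemma kappa_pos: "AE p in N \<Otimes>\<^sub>M N. kappa p > 0"
proof -
  have "AE p in N \<Otimes>\<^sub>M N. inverse (ennreal (kappa p)) \<noteq> \<infinity>"
    using energy_kappa by (intro nn_integral_PInf_AE) auto
  then show ?thesis
    using AE_space
  proof eventually_elim
    case (elim p)
    then show ?case using kappa_nonneg[of p] by (cases "kappa p = 0") auto
  qed
qed

lemma integrable_inverse_kappa: "integrable (N \<Otimes>\<^sub>M N) (\<lambda>p. 1 / kappa p)"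
proof (rule integrableI_bounded)
  have "(\<integral>\<^sup>+p. ennreal (norm (1 / kappa p)) \<partial>(N \<Otimes>\<^sub>M N)) \<le> (\<integral>\<^sup>+p. inverse (ennreal (kappa p)) \<partial>(N \<Otimes>\<^sub>M N))"
  proof (rule nn_integral_mono_AE)
    show "AE p in N \<Otimes>\<^sub>M N. ennreal (norm (1 / kappa p)) \<le> inverse (ennreal (kappa p))"
      using kappa_pos by eventually_elim (simp add: inverse_ennreal divide_inverse)
  qed
  then show "(\<integral>\<^sup>+p. ennreal (norm (1 / kappa p)) \<partial>(N \<Otimes>\<^sub>M N)) < \<infinity>"
    using energy_kappa by (rule le_less_trans)
qed simp

end

section \<open>Local times as limits of time integrals\<close>

text \<open>Boundedness keeps the time integrals of such functions bounded, so that they have all moments. The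
  point \<open>c\<close> may be an end point of the support.\<close>
definition approx_delta :: "real \<Rightarrow> real \<Rightarrow> (real \<Rightarrow> real) \<Rightarrow> bool" where
  "approx_delta c r f \<longleftrightarrow> f \<in> borel_measurable borel \<and> (\<forall>x. 0 \<le> f x) \<and> (\<exists>B. \<forall>x. f x \<le> B) \<and>
     (\<forall>x. \<bar>x - c\<bar> > r \<longrightarrow> f x = 0) \<and> (LINT x|lborel. f x) = 1"

lemma approx_deltaD:
  assumes "approx_delta c r f"
  shows "f \<in> borel_measurable borel" "integrable lborel f" "0 \<le> f x"
    "\<bar>x - c\<bar> > r \<Longrightarrow> f x = 0" "(LINT x|lborel. f x) = 1"
  using assms not_integrable_integral_eq[of lborel f] by (auto simp: approx_delta_def)

lemma approx_delta_mono: "approx_delta c r f \<Longrightarrow> r \<le> r' \<Longrightarrow> approx_delta c r' f"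
  by (auto simp: approx_delta_def)

lemma approx_delta_indicator:
  assumes "a < b" and I: "{a<..<b} \<subseteq> I" "I \<subseteq> {a..b}" and [measurable]: "I \<in> sets borel"
    and r: "c \<in> {a..b}" "b - a \<le> r"
  shows "approx_delta c r (\<lambda>x. indicator I x / (b - a))"
  unfolding approx_delta_def
proof (intro conjI allI)
  have "emeasure lborel I = ennreal (b - a)"
  proof (rule antisym)
    show "emeasure lborel I \<le> ennreal (b - a)"
      using emeasure_mono[OF I(2), of lborel] \<open>a < b\<close> by simp
    show "ennreal (b - a) \<le> emeasure lborel I"
      using emeasure_mono[OF I(1), of lborel] \<open>a < b\<close> by simp
  qed
  then have "measure lborel I = b - a"
    using \<open>a < b\<close> by (simp add: measure_def)
  then show "(LINT x|lborel. indicator I x / (b - a)) = 1"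
    using \<open>a < b\<close> by simp
  show "\<exists>B. \<forall>x. indicator I x / (b - a) \<le> B"
    using \<open>a < b\<close> by (intro exI[of _ "1 / (b - a)"]) (auto split: split_indicator)
  show "\<bar>x - c\<bar> > r \<longrightarrow> indicator I x / (b - a) = 0" for x
    using I(2) r by (auto split: split_indicator dest!: subsetD)
qed (use \<open>a < b\<close> in auto)

context unit_gaussian_process
begin

lemma W_law: "t \<in> space N \<Longrightarrow> distr M borel (W t) = std_normal_distribution"
proof (rule Levy_uniqueness[OF real_distribution_distr real_dist_normal_dist])
  assume t [simp]: "t \<in> space N"
  show "random_variable borel (W t)" by simp
  show "char (distr M borel (W t)) = char std_normal_distribution"
  proof
    fix a
    show "char (distr M borel (W t)) a = char std_normal_distribution a"
      using char[OF t t, of a 0]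
      by (simp add: char_def[of "distr M borel (W t)"] integral_distr char_std_normal_distribution)
  qed
qed

lemma expectation_Z:
  assumes t [simp]: "t \<in> space N" and [measurable]: "f \<in> borel_measurable borel"
  shows "(LINT \<omega>|M. f (Z t \<omega>)) = (LINT x|std_normal_distribution. f (m t + x) :: real)"
proof -
  have "(LINT x|distr M borel (W t). f (m t + x)) = (LINT \<omega>|M. f (Z t \<omega>))"
    by (subst integral_distr) (auto simp: Z_def)
  then show ?thesis by (simp add: W_law)
qed

lemma expectation_Z_le:
  fixes f :: "real \<Rightarrow> real"
  assumes t: "t \<in> space N" and f: "integrable lborel f" and nn: "\<And>x. 0 \<le> f x"
  shows "(LINT \<omega>|M. f (Z t \<omega>)) \<le> (LINT x|lborel. f x)"
proof -
  have [measurable]: "f \<in> borel_measurable borel" using f by auto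
  have shift: "integrable lborel (\<lambda>x. f (m t + x))"
    using lborel_integrable_real_affine[of f 1 "m t", OF f] by simp
  have le: "std_normal_density x * f (m t + x) \<le> f (m t + x)" for x
    using normal_density_le[of 1 0 x] nn[of "m t + x"] by (simp add: mult_left_le_one_le)
  have "(LINT \<omega>|M. f (Z t \<omega>)) = (LINT x|lborel. std_normal_density x * f (m t + x))"
    using t by (subst expectation_Z) (auto simp: integral_density)
  also have "\<dots> \<le> (LINT x|lborel. f (m t + x))"
  proof (rule integral_mono)
    show "integrable lborel (\<lambda>x. std_normal_density x * f (m t + x))"
    proof (rule Bochner_Integration.integrable_bound[OF shift])
      show "AE x in lborel. norm (std_normal_density x * f (m t + x)) \<le> norm (f (m t + x))"
        using nn by (intro AE_I2) (simp only: real_norm_def abs_of_nonneg le mult_nonneg_nonneg normal_density_nonneg)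
    qed simp
  qed (fact shift, rule le)
  also have "\<dots> = (LINT x|lborel. f x)"
    using lborel_integral_real_affine[of 1 f "m t"] by simp
  finally show ?thesis .
qed

text \<open>Decompose \<open>W t = \<rho> W s + \<kappa> V\<close>. The remainder \<open>V\<close> is standard normal and independent of
  \<open>W s\<close>, so averaging over \<open>V\<close> first gives the small factor of \<open>normal_average_small\<close>, uniformly
  in \<open>W s\<close>. The average of \<open>\<bar>h (Z s)\<bar>\<close> is bounded by \<open>2\<close> since \<open>\<bar>h\<bar>\<close> has integral at
  most \<open>2\<close> and the standard normal density is at most \<open>1\<close>.\<close>
lemma two_point_bound:
  assumes s [simp]: "s \<in> space N" and t [simp]: "t \<in> space N" and k: "kappa (s, t) > 0"
    and h: "integrable lborel h" and B: "\<And>y. \<bar>h y\<bar> \<le> B" and h0: "(LINT y|lborel. h y) = 0"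
    and h2: "(LINT y|lborel. \<bar>h y\<bar>) \<le> 2" and supp: "\<And>y. \<bar>y - c\<bar> > r \<Longrightarrow> h y = 0" and r: "r \<ge> 0"
  shows "\<bar>LINT \<omega>|M. h (Z s \<omega>) * h (Z t \<omega>)\<bar> \<le> 4 * min (1 / kappa (s, t)) (r / (kappa (s, t))\<^sup>2)"
proof -
  have [measurable]: "h \<in> borel_measurable borel" using h by auto
  let ?n = "std_normal_distribution"
  define \<rho> where "\<rho> = corr M W s t"
  define k where "k = kappa (s, t)"
  have kpos: "k > 0" using k by (simp add: k_def)
  have k2: "k\<^sup>2 = 1 - \<rho>\<^sup>2"
    using corr_bound[OF s t] by (simp add: k_def kappa_def \<rho>_def abs_square_le_1)
  define V where "V \<omega> = (W t \<omega> - \<rho> * W s \<omega>) / k" for \<omega>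
  have [measurable]: "V \<in> borel_measurable M" unfolding V_def by simp
  have Wt: "W t \<omega> = \<rho> * W s \<omega> + k * V \<omega>" for \<omega>
    using kpos by (simp add: V_def)
  have law: "distr M (borel \<Otimes>\<^sub>M borel) (\<lambda>\<omega>. (W s \<omega>, V \<omega>)) = ?n \<Otimes>\<^sub>M ?n"
  proof (rule gaussian_pair_law)
    fix a b
    have e1: "a * W s \<omega> + b * V \<omega> = (a - b * \<rho> / k) * W s \<omega> + (b / k) * W t \<omega>" for \<omega>
      using kpos by (simp add: V_def field_simps)
    have "(a - b * \<rho> / k)\<^sup>2 + 2 * (a - b * \<rho> / k) * (b / k) * \<rho> + (b / k)\<^sup>2 = a\<^sup>2 + b\<^sup>2 * (1 - \<rho>\<^sup>2) / k\<^sup>2"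
      using kpos by (simp add: power2_eq_square field_simps)
    also have "\<dots> = a\<^sup>2 + b\<^sup>2" using kpos by (simp flip: k2)
    finally show "(CLINT \<omega>|M. iexp (a * W s \<omega> + b * V \<omega>)) = complex_of_real (exp (- (a\<^sup>2 + b\<^sup>2) / 2))"
      unfolding e1 char[OF s t] \<rho>_def[symmetric] by simp
  qed simp_all
  interpret n: prob_space ?n
    using real_dist_normal_dist real_distribution_def by blast
  interpret nn: pair_prob_space ?n ?n ..
  let ?J = "\<lambda>x. LINT v|?n. h ((m t + \<rho> * x) + k * v)"
  let ?K = "min (1 / k) (r / k\<^sup>2)"
  have J: "\<bar>?J x\<bar> \<le> 2 * ?K" for x
    by (rule normal_average_small[OF kpos h h0 h2 supp r])
  have Bnn: "0 \<le> B" using B[of 0] abs_ge_zero order_trans by blast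
  have hh: "\<bar>h x * h y\<bar> \<le> B * B" for x y
    unfolding abs_mult using Bnn by (intro mult_mono B) auto
  have int: "integrable (?n \<Otimes>\<^sub>M ?n) (\<lambda>p. h (m s + fst p) * h (m t + \<rho> * fst p + k * snd p))"
    by (intro nn.P.integrable_const_bound[where B="B * B"]) (use hh in auto)
  have "(LINT \<omega>|M. h (Z s \<omega>) * h (Z t \<omega>))
      = (LINT p|distr M (borel \<Otimes>\<^sub>M borel) (\<lambda>\<omega>. (W s \<omega>, V \<omega>)). h (m s + fst p) * h (m t + \<rho> * fst p + k * snd p))"
    by (subst integral_distr) (auto simp: Z_def Wt add.assoc)
  also have "\<dots> = (LINT x|?n. h (m s + x) * ?J x)"
    unfolding law using nn.integral_fst'[OF int] by simp
  finally have eq: "(LINT \<omega>|M. h (Z s \<omega>) * h (Z t \<omega>)) = (LINT x|?n. h (m s + x) * ?J x)" .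
  have "\<bar>LINT x|?n. h (m s + x) * ?J x\<bar> \<le> (LINT x|?n. \<bar>h (m s + x)\<bar> * (2 * ?K))"
  proof -
    have Jm [measurable]: "?J \<in> borel_measurable ?n"
      by measurable
    have "norm (LINT x|?n. h (m s + x) * ?J x) \<le> (LINT x|?n. \<bar>h (m s + x)\<bar> * (2 * ?K))"
    proof (rule Bochner_Integration.integral_norm_bound_integral)
      show "integrable ?n (\<lambda>x. \<bar>h (m s + x)\<bar> * (2 * ?K))"
        by (intro integrable_mult_left n.integrable_const_bound[where B=B]) (use B in auto)
      then show "integrable ?n (\<lambda>x. h (m s + x) * ?J x)"
        by (rule Bochner_Integration.integrable_bound)
           (use J kpos r in \<open>auto simp: abs_mult intro!: mult_left_mono\<close>)
      show "norm (h (m s + x) * ?J x) \<le> \<bar>h (m s + x)\<bar> * (2 * ?K)" for x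
        using J[of x] by (auto simp: abs_mult intro!: mult_left_mono)
    qed
    then show ?thesis by simp
  qed
  also have "\<dots> = (LINT x|?n. \<bar>h (m s + x)\<bar>) * (2 * ?K)" by (rule integral_mult_left_zero)
  also have "\<dots> \<le> 2 * (2 * ?K)"
  proof (rule mult_right_mono)
    show "(LINT x|?n. \<bar>h (m s + x)\<bar>) \<le> 2"
    proof -
      have "(LINT x|?n. \<bar>h (m s + x)\<bar>) = (LINT \<omega>|M. \<bar>h (Z s \<omega>)\<bar>)"
        by (rule expectation_Z[symmetric]) auto
      also have "\<dots> \<le> (LINT y|lborel. \<bar>h y\<bar>)"
        by (rule expectation_Z_le) (use h in auto)
      finally show ?thesis using h2 by (rule order_trans)
    qed
    show "0 \<le> 2 * ?K" using kpos r by (intro mult_nonneg_nonneg min.boundedI divide_nonneg_nonneg) auto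
  qed
  finally show ?thesis unfolding eq by (simp add: k_def)
qed

definition time_integral :: "(real \<Rightarrow> real) \<Rightarrow> 'w \<Rightarrow> real" where
  "time_integral f \<omega> = (LINT t|N. f (Z t \<omega>))"

lemma integrable_time:
  fixes f :: "real \<Rightarrow> real"
  assumes [measurable]: "f \<in> borel_measurable borel" and B: "\<And>x. \<bar>f x\<bar> \<le> B" and \<omega>: "\<omega> \<in> space M"
  shows "integrable N (\<lambda>t. f (Z t \<omega>))"
  by (intro N.integrable_const_bound[where B=B]) (use B \<omega> in auto)

lemma square_integrable_time_integral:
  fixes f :: "real \<Rightarrow> real"
  assumes [measurable]: "f \<in> borel_measurable borel" and B: "\<And>x. \<bar>f x\<bar> \<le> B"
  shows "square_integrable M (time_integral f)"
proof (rule square_integrable_bounded)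
  show "time_integral f \<in> borel_measurable M"
    unfolding time_integral_def by measurable
  fix \<omega> assume \<omega>: "\<omega> \<in> space M"
  have "\<bar>time_integral f \<omega>\<bar> \<le> (LINT t|N. \<bar>f (Z t \<omega>)\<bar>)"
    unfolding time_integral_def by (rule integral_abs_bound)
  also have "\<dots> \<le> (LINT t|N. B)"
    using integrable_time[OF assms \<omega>] B by (intro integral_mono) auto
  finally show "\<bar>time_integral f \<omega>\<bar> \<le> (LINT t|N. B)" .
qed

lemma approx_delta_square_integrable:
  "approx_delta c r f \<Longrightarrow> square_integrable M (time_integral f)"
  unfolding approx_delta_def by (auto intro!: square_integrable_time_integral)

text \<open>The heart of the construction of local times. Applied to \<open>h = f - g\<close>, \<open>two_point_bound\<close> estimates the
  second moment by an integral over pairs of times that depends on \<open>f\<close> and \<open>g\<close> only through \<open>r\<close>,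
  and that vanishes as \<open>r \<rightarrow> 0\<close> because \<open>1 / kappa\<close> is an integrable majorant.\<close>
lemma approx_delta_L2_close:
  assumes e: "e > 0"
  shows "\<exists>r>0. \<forall>f g. approx_delta c r f \<and> approx_delta c r g \<longrightarrow>
     (LINT \<omega>|M. (time_integral f \<omega> - time_integral g \<omega>)\<^sup>2) \<le> e"
proof -
  let ?P = "N \<Otimes>\<^sub>M N"
  let ?K = "\<lambda>r p. 4 * min (1 / kappa p) (r / (kappa p)\<^sup>2)"
  have "(\<lambda>n. LINT p|?P. ?K (1 / real (Suc n)) p) \<longlonglongrightarrow> (LINT p|?P. 0)"
  proof (rule integral_dominated_convergence[where w="\<lambda>p. 4 * (1 / kappa p)"])
    show "integrable ?P (\<lambda>p. 4 * (1 / kappa p))"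
      using integrable_inverse_kappa by (rule integrable_mult_right)
    show "AE p in ?P. (\<lambda>n. ?K (1 / real (Suc n)) p) \<longlonglongrightarrow> 0"
      using kappa_pos
    proof eventually_elim
      case (elim p)
      have "(\<lambda>n. 4 * min (1 / kappa p) (1 / real (Suc n) / (kappa p)\<^sup>2))
          \<longlonglongrightarrow> 4 * min (1 / kappa p) (0 / (kappa p)\<^sup>2)"
        using elim by (intro tendsto_intros LIMSEQ_Suc lim_1_over_n) auto
      then show ?case using elim by simp
    qed
    show "AE p in ?P. norm (?K (1 / real (Suc n)) p) \<le> 4 * (1 / kappa p)" for n
      using kappa_pos by eventually_elim (simp add: abs_of_nonneg del: min_less_iff_conj)
  qed auto
  then have "(\<lambda>n. LINT p|?P. ?K (1 / real (Suc n)) p) \<longlonglongrightarrow> 0" by simp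
  from order_tendstoD(2)[OF this e] obtain n where n: "(LINT p|?P. ?K (1 / real (Suc n)) p) < e"
    by (auto simp: eventually_sequentially)
  define r where "r = 1 / real (Suc n)"
  have r: "r > 0" by (simp add: r_def)
  have "(LINT \<omega>|M. (time_integral f \<omega> - time_integral g \<omega>)\<^sup>2) \<le> e"
    if f: "approx_delta c r f" and g: "approx_delta c r g" for f g
  proof -
    note D = approx_deltaD[OF f] approx_deltaD[OF g]
    note [measurable] = D(1,6)
    obtain B1 B2 where B: "\<And>x. f x \<le> B1" "\<And>x. g x \<le> B2"
      using f g unfolding approx_delta_def by blast
    define h where "h x = f x - g x" for x
    have hB: "\<bar>h x\<bar> \<le> B1 + B2" for x
      using B(1)[of x] B(2)[of x] D(3)[of x] D(8)[of x] by (auto simp: h_def abs_le_iff)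
    have [measurable]: "h \<in> borel_measurable borel" unfolding h_def by measurable
    have hint: "integrable lborel h" unfolding h_def using D(2,7) by simp
    have h0: "(LINT x|lborel. h x) = 0" unfolding h_def using D by simp
    have h2: "(LINT x|lborel. \<bar>h x\<bar>) \<le> 2"
    proof -
      have "(LINT x|lborel. \<bar>h x\<bar>) \<le> (LINT x|lborel. f x + g x)"
        using hint D(2,7) D(3) D(8) by (intro integral_mono) (auto simp: h_def abs_le_iff)
      then show ?thesis using D by simp
    qed
    have supp: "h x = 0" if "\<bar>x - c\<bar> > r" for x
      using D(4)[OF that] D(9)[OF that] by (simp add: h_def)
    have "(LINT \<omega>|M. (time_integral f \<omega> - time_integral g \<omega>)\<^sup>2) = (LINT \<omega>|M. (LINT t|N. h (Z t \<omega>))\<^sup>2)"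
    proof (intro Bochner_Integration.integral_cong refl)
      fix \<omega> assume \<omega>: "\<omega> \<in> space M"
      have "integrable N (\<lambda>t. f (Z t \<omega>))" "integrable N (\<lambda>t. g (Z t \<omega>))"
        using B D(3,8) by (auto intro!: integrable_time[OF _ _ \<omega>])
      then show "(time_integral f \<omega> - time_integral g \<omega>)\<^sup>2 = (LINT t|N. h (Z t \<omega>))\<^sup>2"
        by (simp add: time_integral_def h_def)
    qed
    also have "\<dots> = (LINT p|?P. (LINT \<omega>|M. h (Z (fst p) \<omega>) * h (Z (snd p) \<omega>)))"
      by (rule second_moment_time_integral[where B="B1 + B2"]) (use hB in auto)
    also have "\<dots> \<le> (LINT p|?P. ?K r p)"
    proof (rule integral_mono_AE)
      show "integrable ?P (\<lambda>p. LINT \<omega>|M. h (Z (fst p) \<omega>) * h (Z (snd p) \<omega>))"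
        by (rule second_moment_time_integral[where B="B1 + B2"]) (use hB in auto)
      show "integrable ?P (\<lambda>p. ?K r p)"
      proof (rule Bochner_Integration.integrable_bound)
        show "integrable ?P (\<lambda>p. 4 * (1 / kappa p))"
          using integrable_inverse_kappa by (rule integrable_mult_right)
        show "AE p in ?P. norm (?K r p) \<le> norm (4 * (1 / kappa p))"
          using kappa_pos by eventually_elim (use r in \<open>simp add: abs_of_nonneg del: min_less_iff_conj\<close>)
      qed measurable
      show "AE p in ?P. (LINT \<omega>|M. h (Z (fst p) \<omega>) * h (Z (snd p) \<omega>)) \<le> ?K r p"
        using kappa_pos AE_space
      proof eventually_elim
        case (elim p)
        then have "fst p \<in> space N" "snd p \<in> space N" by (auto simp: space_pair_measure)
        from two_point_bound[OF this _ hint hB h0 h2 supp, of r] elim(1) r show ?case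
          by (auto simp: abs_le_iff)
      qed
    qed
    also have "\<dots> \<le> e" using n by (simp add: r_def)
    finally show ?thesis .
  qed
  with r show ?thesis by blast
qed

text \<open>By completeness one particular sequence of densities has a limit, and by
  \<open>approx_delta_L2_close\<close> all others are close to that sequence.\<close>
lemma local_time_at_level:
  "\<exists>L. square_integrable M L \<and> (\<forall>e>0. \<exists>r>0. \<forall>f. approx_delta c r f \<longrightarrow>
     (LINT \<omega>|M. (time_integral f \<omega> - L \<omega>)\<^sup>2) \<le> e)"
proof -
  define F :: "nat \<Rightarrow> real \<Rightarrow> real" where
    "F n x = indicator {c..c + 1 / real (Suc n)} x / ((c + 1 / real (Suc n)) - c)" for n x
  have F: "approx_delta c r (F n)" if "1 / real (Suc n) \<le> r" for n r
  proof -
    have "c < c + 1 / real (Suc n)" by simp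
    then show ?thesis
      unfolding F_def by (rule approx_delta_indicator) (use that in \<open>auto simp del: of_nat_Suc\<close>)
  qed
  have Fev: "\<exists>n0. \<forall>n\<ge>n0. approx_delta c r (F n)" if "r > 0" for r
  proof -
    obtain n0 where n0: "1 / real (Suc n0) < r"
      by (rule nat_approx_posE[OF \<open>r > 0\<close>])
    have "approx_delta c r (F n)" if "n \<ge> n0" for n
    proof (rule F)
      have "1 / real (Suc n) \<le> 1 / real (Suc n0)" using that by (simp add: frac_le)
      then show "1 / real (Suc n) \<le> r" using n0 by simp
    qed
    then show ?thesis by blast
  qed
  have Fsq: "square_integrable M (time_integral (F n))" for n
    using F[of n] by (intro approx_delta_square_integrable) auto
  have "\<exists>n0. \<forall>m\<ge>n0. \<forall>n\<ge>n0. (LINT \<omega>|M. (time_integral (F m) \<omega> - time_integral (F n) \<omega>)\<^sup>2) \<le> e"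
    if e: "e > 0" for e
  proof -
    from approx_delta_L2_close[OF e, of c] obtain r where r: "r > 0"
      "\<And>f g. approx_delta c r f \<Longrightarrow> approx_delta c r g \<Longrightarrow>
        (LINT \<omega>|M. (time_integral f \<omega> - time_integral g \<omega>)\<^sup>2) \<le> e" by blast
    obtain n0 where "\<And>n. n \<ge> n0 \<Longrightarrow> approx_delta c r (F n)" using Fev[OF r(1)] by blast
    then show ?thesis using r(2) by (intro exI[of _ n0] allI impI) simp
  qed
  from L2_complete[OF Fsq this] obtain l where l: "square_integrable M l"
    and lim: "(\<lambda>n. LINT \<omega>|M. (time_integral (F n) \<omega> - l \<omega>)\<^sup>2) \<longlonglongrightarrow> 0" by blast
  have "\<exists>r>0. \<forall>f. approx_delta c r f \<longrightarrow> (LINT \<omega>|M. (time_integral f \<omega> - l \<omega>)\<^sup>2) \<le> e" if "e > 0" for e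
  proof -
    from that have "e / 4 > 0" by simp
    from approx_delta_L2_close[OF this, of c] obtain r where r: "r > 0"
      "\<And>f g. approx_delta c r f \<Longrightarrow> approx_delta c r g \<Longrightarrow>
        (LINT \<omega>|M. (time_integral f \<omega> - time_integral g \<omega>)\<^sup>2) \<le> e / 4" by blast
    obtain n0 where n0: "\<And>n. n \<ge> n0 \<Longrightarrow> approx_delta c r (F n)" using Fev[OF r(1)] by blast
    obtain n where n: "n \<ge> n0" "(LINT \<omega>|M. (time_integral (F n) \<omega> - l \<omega>)\<^sup>2) < e / 4"
      using eventually_conj[OF order_tendstoD(2)[OF lim \<open>e / 4 > 0\<close>] eventually_ge_at_top[of n0]]
      by (auto simp: eventually_sequentially)
    have "(LINT \<omega>|M. (time_integral f \<omega> - l \<omega>)\<^sup>2) \<le> e" if f: "approx_delta c r f" for f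
      using L2_dist_triangle[OF approx_delta_square_integrable[OF f] Fsq[of n] l] n r(2)[OF f n0[OF n(1)]]
      by linarith
    with r(1) show ?thesis by blast
  qed
  with l show ?thesis by blast
qed

text \<open>The local time of \<open>Z\<close>, not of its absolute value, at level \<open>c\<close>. It is determined up to null sets, and a
  version is chosen.\<close>
definition level_local_time :: "real \<Rightarrow> 'w \<Rightarrow> real" where
  "level_local_time c = (SOME L. square_integrable M L \<and> (\<forall>e>0. \<exists>r>0. \<forall>f. approx_delta c r f \<longrightarrow>
     (LINT \<omega>|M. (time_integral f \<omega> - L \<omega>)\<^sup>2) \<le> e))"

lemma L2_tendsto_level_local_time:
  assumes f: "\<forall>\<^sub>F b in F. approx_delta c (r b) (f b)" and r: "(r \<longlongrightarrow> 0) F"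
  shows "L2_tendsto M (\<lambda>b. time_integral (f b)) (level_local_time c) F"
proof -
  note l = someI_ex[OF local_time_at_level[of c], folded level_local_time_def]
  show ?thesis
    unfolding L2_tendsto_def
  proof (intro conjI)
    show "\<forall>\<^sub>F b in F. square_integrable M (time_integral (f b))"
      using f by eventually_elim (rule approx_delta_square_integrable)
    show "square_integrable M (level_local_time c)" using l by blast
    show "((\<lambda>b. LINT \<omega>|M. (time_integral (f b) \<omega> - level_local_time c \<omega>)\<^sup>2) \<longlongrightarrow> 0) F"
    proof (rule tendstoI)
      fix e :: real assume "e > 0"
      then have "e / 2 > 0" by simp
      with l obtain \<delta> where \<delta>: "\<delta> > 0" "\<And>f. approx_delta c \<delta> f \<Longrightarrow>
          (LINT \<omega>|M. (time_integral f \<omega> - level_local_time c \<omega>)\<^sup>2) \<le> e / 2" by blast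
      show "\<forall>\<^sub>F b in F. dist (LINT \<omega>|M. (time_integral (f b) \<omega> - level_local_time c \<omega>)\<^sup>2) 0 < e"
        using f order_tendstoD(2)[OF r \<delta>(1)]
      proof eventually_elim
        case (elim b)
        then have "approx_delta c \<delta> (f b)" by (meson approx_delta_mono less_imp_le)
        from \<delta>(2)[OF this] \<open>e > 0\<close> show ?case by simp
      qed
    qed
  qed
qed

text \<open>Of the two indicators in the second moment one is bounded by \<open>1\<close>; the other has small mean
  because each \<open>Z t\<close> has a density that is at most \<open>1\<close>.\<close>
lemma time_near_level_small:
  assumes "r \<ge> 0"
  shows "(LINT \<omega>|M. (time_integral (indicator {x. \<bar>\<bar>x\<bar> - l\<bar> \<le> r}) \<omega>)\<^sup>2)
    \<le> 4 * r * measure (N \<Otimes>\<^sub>M N) (space (N \<Otimes>\<^sub>M N))"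
proof -
  let ?P = "N \<Otimes>\<^sub>M N" and ?A = "{x. \<bar>\<bar>x\<bar> - l\<bar> \<le> r}"
  let ?i = "indicator ?A :: real \<Rightarrow> real"
  have [measurable]: "?A \<in> sets borel" by measurable
  let ?c = "\<lambda>x. indicator {l - r..l + r} x + indicator {- l - r..- l + r} x :: real"
  have iint: "integrable lborel ?c"
    by (intro Bochner_Integration.integrable_add integrable_real_indicator) (auto simp: emeasure_lborel_Icc_eq)
  have ic: "?i x \<le> ?c x" for x by (auto split: split_indicator)
  have "(LINT \<omega>|M. (time_integral ?i \<omega>)\<^sup>2)
      = (LINT p|?P. (LINT \<omega>|M. ?i (Z (fst p) \<omega>) * ?i (Z (snd p) \<omega>)))"
    unfolding time_integral_def
    by (rule second_moment_time_integral[where B=1]) (auto split: split_indicator)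
  also have "\<dots> \<le> (LINT p|?P. 4 * r)"
  proof (rule integral_mono)
    show "integrable ?P (\<lambda>p. LINT \<omega>|M. ?i (Z (fst p) \<omega>) * ?i (Z (snd p) \<omega>))"
      by (rule second_moment_time_integral[where B=1]) (auto split: split_indicator)
    fix p assume "p \<in> space ?P"
    then have [simp]: "fst p \<in> space N" "snd p \<in> space N" by (auto simp: space_pair_measure)
    have "(LINT \<omega>|M. ?i (Z (fst p) \<omega>) * ?i (Z (snd p) \<omega>)) \<le> (LINT \<omega>|M. ?c (Z (fst p) \<omega>))"
    proof (rule integral_mono)
      show "integrable M (\<lambda>\<omega>. ?i (Z (fst p) \<omega>) * ?i (Z (snd p) \<omega>))"
        by (intro integrable_const_bound[where B=1]) (auto split: split_indicator)
      show "integrable M (\<lambda>\<omega>. ?c (Z (fst p) \<omega>))"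
        by (intro integrable_const_bound[where B=2]) (auto split: split_indicator)
      show "?i (Z (fst p) \<omega>) * ?i (Z (snd p) \<omega>) \<le> ?c (Z (fst p) \<omega>)" for \<omega>
        using ic[of "Z (fst p) \<omega>"] by (auto split: split_indicator)
    qed
    also have "\<dots> \<le> (LINT x|lborel. ?c x)"
      by (rule expectation_Z_le[OF _ iint]) auto
    also have "\<dots> = 4 * r"
      using assms by (subst Bochner_Integration.integral_add) auto
    finally show "(LINT \<omega>|M. ?i (Z (fst p) \<omega>) * ?i (Z (snd p) \<omega>)) \<le> 4 * r" .
  qed simp
  finally show ?thesis by (simp add: mult_ac)
qed

lemma AE_time_off_level:
  "AE \<omega> in M. AE t in N. \<bar>Z t \<omega>\<bar> \<noteq> l"
proof -
  let ?i = "indicator {x. \<bar>\<bar>x\<bar> - l\<bar> \<le> 0} :: real \<Rightarrow> real"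
  have sq: "square_integrable M (time_integral ?i)"
    by (rule square_integrable_time_integral[where B=1]) (auto split: split_indicator)
  have "(LINT \<omega>|M. (time_integral ?i \<omega>)\<^sup>2) \<le> 0"
    using time_near_level_small[of 0 l] by simp
  then have "(LINT \<omega>|M. (time_integral ?i \<omega>)\<^sup>2) = 0"
    by (intro antisym Bochner_Integration.integral_nonneg) auto
  then have "AE \<omega> in M. (time_integral ?i \<omega>)\<^sup>2 = 0"
    using sq by (subst (asm) integral_nonneg_eq_0_iff_AE) (auto simp: square_integrable_def)
  then show ?thesis
    using AE_space
  proof eventually_elim
    case (elim \<omega>)
    have "integrable N (\<lambda>t. ?i (Z t \<omega>))"
      by (rule integrable_time[where B=1]) (use elim in \<open>auto split: split_indicator\<close>)
    then have "AE t in N. ?i (Z t \<omega>) = 0"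
      using elim by (subst integral_nonneg_eq_0_iff_AE[symmetric]) (auto simp: time_integral_def)
    then show ?case by eventually_elim (auto split: split_indicator_asm)
  qed
qed

end

section \<open>The mollified threshold function\<close>

lemma antiderivative_exists:
  fixes f :: "real \<Rightarrow> real"
  assumes "\<And>x. isCont f x"
  shows "\<exists>F. \<forall>x. (F has_real_derivative f x) (at x)"
  using einterval_antiderivative[of "-\<infinity>" "\<infinity>" f] assms
  by (simp add: has_real_derivative_iff_has_vector_derivative)

lemma mollifierD:
  assumes "mollifier \<phi>"
  shows "0 \<le> \<phi> x" "\<bar>x\<bar> > 1 \<Longrightarrow> \<phi> x = 0" "isCont \<phi> x" "\<phi> \<in> borel_measurable borel"
    "(LINT x:{-1..1}|lborel. \<phi> x) = 1"
proof -
  have c: "isCont \<phi> x" for x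
  proof -
    have "(deriv ^^ 0) \<phi> field_differentiable at x"
      using assms unfolding mollifier_def by blast
    then show ?thesis by (simp add: field_differentiable_imp_continuous_at)
  qed
  then show "isCont \<phi> x" .
  show "\<phi> \<in> borel_measurable borel"
    by (intro borel_measurable_continuous_onI continuous_at_imp_continuous_on) (use c in auto)
qed (use assms in \<open>auto simp: mollifier_def\<close>)

lemma mollifier_antiderivative:
  assumes \<phi>: "mollifier \<phi>"
  obtains A where "\<And>x. (A has_real_derivative \<phi> x) (at x)"
    "\<And>x. x \<le> -1 \<Longrightarrow> A x = 0" "\<And>x. x \<ge> 1 \<Longrightarrow> A x = 1" "\<And>x y. x \<le> y \<Longrightarrow> A x \<le> A y"
proof -
  obtain F where F: "\<And>x. (F has_real_derivative \<phi> x) (at x)"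
    using antiderivative_exists[of \<phi>] mollifierD(3)[OF \<phi>] by blast
  define A where "A x = F x - F (-1)" for x
  have A: "(A has_real_derivative \<phi> x) (at x)" for x
    unfolding A_def using F by (auto intro!: derivative_eq_intros)
  have cont: "continuous_on S A" for S
    using A by (meson DERIV_isCont continuous_at_imp_continuous_on)
  have const: "A x = A y" if "x < y" "\<And>z. x < z \<Longrightarrow> z < y \<Longrightarrow> \<bar>z\<bar> > 1" for x y
  proof (rule DERIV_isconst_end[symmetric, OF that(1) cont])
    fix z assume "x < z" "z < y"
    then have "\<phi> z = 0" by (intro mollifierD(2)[OF \<phi>] that(2))
    then show "(A has_real_derivative 0) (at z)" using A[of z] by simp
  qed
  have eq_low: "A x = A (-1)" if "x \<le> -1" for x
  proof (cases "x = -1")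
    case False
    with that have "x < -1" by simp
    then show ?thesis by (rule const) linarith
  qed simp
  have low: "A x = 0" if "x \<le> -1" for x
    unfolding eq_low[OF that] by (simp add: A_def)
  have "(LINT x|lborel. \<phi> x * indicator {-1..1} x) = A 1 - A (-1)"
    by (rule integral_FTC_Icc_real) (use A mollifierD(3)[OF \<phi>] in auto)
  then have "A 1 = 1"
    using mollifierD(5)[OF \<phi>] low[of "-1"] by (simp add: set_lebesgue_integral_def mult.commute)
  have eq_up: "A x = A 1" if "x \<ge> 1" for x
  proof (cases "x = 1")
    case False
    with that have "1 < x" by simp
    then show ?thesis by (rule const[symmetric]) linarith
  qed simp
  have up: "A x = 1" if "x \<ge> 1" for x
    unfolding eq_up[OF that] by fact
  have "A x \<le> A y" if "x \<le> y" for x y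
    by (rule DERIV_nonneg_imp_nondecreasing[OF that]) (use A mollifierD(1)[OF \<phi>] in blast)
  with A low up show thesis using that by blast
qed

lemma approx_delta_rescale:
  assumes \<phi>: "mollifier \<phi>" and e: "\<epsilon> > 0"
  shows "approx_delta c \<epsilon> (\<lambda>x. rescale \<phi> \<epsilon> (x - c))"
  unfolding approx_delta_def
proof (intro conjI allI)
  note D = mollifierD[OF \<phi>]
  note [measurable] = D(4)
  show "(\<lambda>x. rescale \<phi> \<epsilon> (x - c)) \<in> borel_measurable borel"
    unfolding rescale_def by measurable
  show "0 \<le> rescale \<phi> \<epsilon> (x - c)" for x
    using D(1) e by (simp add: rescale_def)
  show "\<bar>x - c\<bar> > \<epsilon> \<longrightarrow> rescale \<phi> \<epsilon> (x - c) = 0" for x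
    using D(2)[of "(x - c) / \<epsilon>"] e by (simp add: rescale_def)
  have "compact (\<phi> ` {-1..1})"
    by (intro compact_continuous_image continuous_at_imp_continuous_on) (use D(3) in auto)
  then obtain B where B: "\<forall>x\<in>{-1..1}. \<bar>\<phi> x\<bar> \<le> B"
    using compact_imp_bounded[of "\<phi> ` {-1..1}"] unfolding bounded_iff by auto
  have B': "\<phi> x \<le> \<bar>B\<bar>" for x
    using B[rule_format, of x] D(2)[of x] by (cases "\<bar>x\<bar> > 1") (auto simp: not_less abs_le_iff)
  show "\<exists>B. \<forall>x. rescale \<phi> \<epsilon> (x - c) \<le> B"
    using B' e by (intro exI[of _ "\<bar>B\<bar> / \<epsilon>"]) (auto simp: rescale_def divide_right_mono)
  have "(LINT x|lborel. rescale \<phi> \<epsilon> (x - c)) = (LINT x|lborel. \<phi> x)"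
    using e lborel_integral_real_affine[of \<epsilon> "\<lambda>x. rescale \<phi> \<epsilon> (x - c)" c]
    by (simp add: rescale_def)
  also have "\<dots> = (LINT x|lborel. indicator {-1..1} x *\<^sub>R \<phi> x)"
    using D(2) by (intro Bochner_Integration.integral_cong) (auto split: split_indicator)
  also have "\<dots> = 1" using D(5) by (simp add: set_lebesgue_integral_def)
  finally show "(LINT x|lborel. rescale \<phi> \<epsilon> (x - c)) = 1" .
qed

text \<open>With \<open>q = x - a\<close>, \<open>\<Phi>\<close> the rescaled mollifier and \<open>B\<close> an antiderivative of \<open>y \<Phi>(y)\<close>, the
  convolution equals \<open>- q (A((q + b)/\<eta>) - A((q - b)/\<eta>)) + B(q + b) - B(q - b)\<close>. In its derivative the
  terms \<open>q \<Phi>(q \<plusminus> b)\<close> cancel and the jump heights \<open>b\<close> remain.\<close>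
lemma convolve_threshold_has_derivative:
  fixes \<phi> A :: "real \<Rightarrow> real"
  assumes cont: "\<And>x. isCont \<phi> x" and A: "\<And>x. (A has_real_derivative \<phi> x) (at x)"
    and \<eta>: "\<eta> > 0" and b: "b \<ge> 0"
  shows "(convolve (rescale \<phi> \<eta>) (\<lambda>x. - (x - a) * (if \<bar>x - a\<bar> < b then 1 else 0)) has_real_derivative
      - (A ((x - a + b) / \<eta>) - A ((x - a - b) / \<eta>))
      + b * (rescale \<phi> \<eta> (x - a + b) + rescale \<phi> \<eta> (x - a - b))) (at x)"
proof -
  let ?\<Phi> = "rescale \<phi> \<eta>"
  have c\<Phi>: "isCont ?\<Phi> y" for y
    unfolding rescale_def using \<eta> by (auto intro!: continuous_intros isCont_o2[OF _ cont])
  have A': "((\<lambda>y. A (y / \<eta>)) has_real_derivative ?\<Phi> y) (at y)" for y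
  proof -
    have "((\<lambda>y. y / \<eta>) has_real_derivative 1 / \<eta>) (at y)"
      using \<eta> by (auto intro!: derivative_eq_intros)
    from DERIV_chain2[OF A this] show ?thesis by (simp add: rescale_def)
  qed
  obtain B where B: "\<And>y. (B has_real_derivative y * ?\<Phi> y) (at y)"
    using antiderivative_exists[of "\<lambda>y. y * ?\<Phi> y"] c\<Phi> by (auto intro: continuous_intros)
  have val: "convolve ?\<Phi> (\<lambda>x. - (x - a) * (if \<bar>x - a\<bar> < b then 1 else 0)) x
      = - (x - a) * (A ((x - a + b) / \<eta>) - A ((x - a - b) / \<eta>)) + (B (x - a + b) - B (x - a - b))" for x
  proof -
    let ?q = "x - a"
    have [measurable]: "?\<Phi> \<in> borel_measurable borel"
      by (intro borel_measurable_continuous_onI continuous_at_imp_continuous_on) (use c\<Phi> in auto)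
    have "convolve ?\<Phi> (\<lambda>x. - (x - a) * (if \<bar>x - a\<bar> < b then 1 else 0)) x
        = (LINT y|lborel. (?\<Phi> y * (y - ?q)) * indicator {?q - b..?q + b} y)"
      unfolding convolve_def
    proof (rule integral_cong_AE)
      show "AE y in lborel. ?\<Phi> y * (- (x - y - a) * (if \<bar>x - y - a\<bar> < b then 1 else 0))
          = ?\<Phi> y * (y - ?q) * indicator {?q - b..?q + b} y"
        using AE_lborel_singleton[of "?q - b"] AE_lborel_singleton[of "?q + b"]
        by eventually_elim (auto split: split_indicator simp: abs_less_iff algebra_simps)
    qed measurable
    also have "\<dots> = (- ?q * A ((?q + b) / \<eta>) + B (?q + b)) - (- ?q * A ((?q - b) / \<eta>) + B (?q - b))"
    proof (rule integral_FTC_Icc_real[where F="\<lambda>y. - ?q * A (y / \<eta>) + B y"])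
      show "((\<lambda>y. - ?q * A (y / \<eta>) + B y) has_real_derivative ?\<Phi> y * (y - ?q)) (at y)" for y
        by (rule derivative_eq_intros A' B refl)+ (simp add: algebra_simps)
      show "isCont (\<lambda>y. ?\<Phi> y * (y - ?q)) y" for y
        by (intro continuous_intros c\<Phi>)
    qed (use b in simp)
    finally show ?thesis by (simp add: algebra_simps)
  qed
  have shift: "((\<lambda>x. x - a + b) has_real_derivative 1) (at x)" "((\<lambda>x. x - a - b) has_real_derivative 1) (at x)"
    by (auto intro!: derivative_eq_intros)
  note chain = DERIV_chain2[OF A' shift(1)] DERIV_chain2[OF A' shift(2)]
    DERIV_chain2[OF B shift(1)] DERIV_chain2[OF B shift(2)]
  show ?thesis
    unfolding val
    by (rule derivative_eq_intros chain refl)+ (simp add: algebra_simps)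
qed

text \<open>If \<open>A\<close> is the distribution function of the mollifier, the difference on the left is the indicator of
  \<open>[-l, l]\<close> convolved with the rescaled mollifier; smoothing at scale \<open>\<epsilon>\<close> changes the indicator
  only within distance \<open>\<epsilon>\<close> of its jumps.\<close>
lemma smoothed_window_error:
  fixes A :: "real \<Rightarrow> real"
  assumes low: "\<And>x. x \<le> -1 \<Longrightarrow> A x = 0" and up: "\<And>x. x \<ge> 1 \<Longrightarrow> A x = 1"
    and mono: "\<And>x y. x \<le> y \<Longrightarrow> A x \<le> A y" and e: "\<epsilon> > 0" and l: "l \<ge> 0"
  shows "\<bar>(A ((z + l) / \<epsilon>) - A ((z - l) / \<epsilon>)) - indicator {z. \<bar>z\<bar> \<le> l} z\<bar> \<le> indicator {z. \<bar>\<bar>z\<bar> - l\<bar> \<le> \<epsilon>} z"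
proof -
  have rng: "0 \<le> A x \<and> A x \<le> 1" for x
    using mono[of "min x (-1)" x] mono[of x "max x 1"] low[of "min x (-1)"] up[of "max x 1"] by simp
  have m: "A ((z - l) / \<epsilon>) \<le> A ((z + l) / \<epsilon>)"
    using e l by (intro mono) (simp add: divide_right_mono)
  show ?thesis
  proof (cases "\<bar>\<bar>z\<bar> - l\<bar> \<le> \<epsilon>")
    case True
    then show ?thesis
      using m rng[of "(z - l) / \<epsilon>"] rng[of "(z + l) / \<epsilon>"] by (auto split: split_indicator)
  next
    case False
    then consider "\<bar>z\<bar> < l - \<epsilon>" | "z > l + \<epsilon>" | "- z > l + \<epsilon>" by linarith
    then show ?thesis
    proof cases
      case 1
      then have "(z + l) / \<epsilon> \<ge> 1" "(z - l) / \<epsilon> \<le> -1" using e by (auto simp: field_simps)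
      then show ?thesis using up low 1 e by (simp split: split_indicator)
    next
      case 2
      then have "(z + l) / \<epsilon> \<ge> 1" "(z - l) / \<epsilon> \<ge> 1" using e l by (auto simp: field_simps)
      then show ?thesis using up 2 e l by (simp split: split_indicator)
    next
      case 3
      then have "(z + l) / \<epsilon> \<le> -1" "(z - l) / \<epsilon> \<le> -1" using e l by (auto simp: field_simps)
      then show ?thesis using low 3 e l by (simp split: split_indicator)
    qed
  qed
qed

text \<open>The derivative of the mollified threshold function in the normalized variable
  \<open>z = (x - \<alpha> t) / \<surd>(\<gamma> t t)\<close>, with \<open>A\<close> the distribution function of \<open>\<phi>\<close>.\<close>
definition gradient_kernel :: "(real \<Rightarrow> real) \<Rightarrow> (real \<Rightarrow> real) \<Rightarrow> real \<Rightarrow> real \<Rightarrow> real \<Rightarrow> real" where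
  "gradient_kernel \<phi> A l \<epsilon> z = - (A ((z + l) / \<epsilon>) - A ((z - l) / \<epsilon>))
      + l * (rescale \<phi> \<epsilon> (z + l) + rescale \<phi> \<epsilon> (z - l))"

context unit_gaussian_process
begin

definition occupation :: "real \<Rightarrow> 'w \<Rightarrow> real" where
  "occupation a = time_integral (indicator {z. \<bar>z\<bar> \<le> a})"

lemma time_integral_lincomb:
  assumes \<omega>: "\<omega> \<in> space M"
    and "f \<in> borel_measurable borel" "\<And>x. \<bar>f x\<bar> \<le> B" "g \<in> borel_measurable borel" "\<And>x. \<bar>g x\<bar> \<le> C"
  shows "time_integral (\<lambda>x. u * f x + v * g x) \<omega> = u * time_integral f \<omega> + v * time_integral g \<omega>"
  unfolding time_integral_def
  using integrable_time[OF assms(2,3) \<omega>] integrable_time[OF assms(4,5) \<omega>] by simp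

lemma approx_delta_bounded:
  assumes "approx_delta c r f"
  obtains B where "\<And>x. \<bar>f x\<bar> \<le> B"
  using assms unfolding approx_delta_def by (metis abs_of_nonneg)

text \<open>For \<open>a\<close> on either side of \<open>l\<close>, the difference quotient is the time integral of two normalized
  indicators of intervals between \<open>a\<close> and \<open>l\<close> and between \<open>-a\<close> and \<open>-l\<close>. For \<open>l = 0\<close> both
  concentrate at zero, and the local time of \<open>\<bar>Z\<bar>\<close> is twice that of \<open>Z\<close>.\<close>
lemma occupation_has_L2_derivative:
  assumes l: "l \<ge> 0"
  shows "L2_tendsto M (\<lambda>a \<omega>. (occupation a \<omega> - occupation l \<omega>) / (a - l))
    (\<lambda>\<omega>. level_local_time l \<omega> + level_local_time (- l) \<omega>) (at l within {0..})"
proof -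
  let ?F = "at l within {0..}"
  define p where "p a x = indicator {min a l<..max a l} x / (max a l - min a l)" for a x :: real
  define n where "n a x = indicator {- max a l..<- min a l} x / (- min a l - - max a l)" for a x :: real
  have ev: "\<forall>\<^sub>F a in ?F. a \<in> {0..} \<and> a \<noteq> l"
    by (auto simp: eventually_at_filter)
  have pd: "approx_delta l \<bar>a - l\<bar> (p a)" and nd: "approx_delta (- l) \<bar>a - l\<bar> (n a)" if "a \<noteq> l" for a
  proof -
    have "min a l < max a l" "- max a l < - min a l" using that by auto
    show "approx_delta l \<bar>a - l\<bar> (p a)"
      unfolding p_def using \<open>min a l < max a l\<close> by (rule approx_delta_indicator) auto
    show "approx_delta (- l) \<bar>a - l\<bar> (n a)"
      unfolding n_def using \<open>- max a l < - min a l\<close> by (rule approx_delta_indicator) auto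
  qed
  have r: "((\<lambda>a. \<bar>a - l\<bar>) \<longlongrightarrow> 0) ?F"
  proof -
    have "((\<lambda>a. \<bar>a - l\<bar>) \<longlongrightarrow> \<bar>l - l\<bar>) ?F" by (intro tendsto_intros)
    then show ?thesis by simp
  qed
  have P: "L2_tendsto M (\<lambda>a. time_integral (p a)) (level_local_time l) ?F"
    by (rule L2_tendsto_level_local_time[OF _ r]) (use ev pd in \<open>auto elim!: eventually_mono\<close>)
  have Q: "L2_tendsto M (\<lambda>a. time_integral (n a)) (level_local_time (- l)) ?F"
    by (rule L2_tendsto_level_local_time[OF _ r]) (use ev nd in \<open>auto elim!: eventually_mono\<close>)
  show ?thesis
  proof (rule L2_tendsto_cong[OF L2_tendsto_lincomb[OF P Q, of 1 1]])
    show "\<forall>\<^sub>F a in ?F. \<forall>\<omega>\<in>space M. 1 * time_integral (p a) \<omega> + 1 * time_integral (n a) \<omega>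
        = (occupation a \<omega> - occupation l \<omega>) / (a - l)"
      using ev
    proof eventually_elim
      case (elim a)
      then have a: "a \<ge> 0" "a \<noteq> l" by auto
      show ?case
      proof
        fix \<omega> assume \<omega>: "\<omega> \<in> space M"
        obtain Bp Bn where Bp: "\<And>x. \<bar>p a x\<bar> \<le> Bp" and Bn: "\<And>x. \<bar>n a x\<bar> \<le> Bn"
          using approx_delta_bounded[OF pd[OF a(2)]] approx_delta_bounded[OF nd[OF a(2)]] by metis
        have pt: "1 * p a x + 1 * n a x
            = 1 / (a - l) * indicator {z. \<bar>z\<bar> \<le> a} x + (- 1 / (a - l)) * indicator {z. \<bar>z\<bar> \<le> l} x" for x
          using a l by (cases "a < l") (auto simp: p_def n_def field_simps split: split_indicator)
        have "1 * time_integral (p a) \<omega> + 1 * time_integral (n a) \<omega> = time_integral (\<lambda>x. 1 * p a x + 1 * n a x) \<omega>"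
          by (rule time_integral_lincomb[symmetric, OF \<omega> _ Bp _ Bn])
             (use pd[OF a(2)] nd[OF a(2)] in \<open>auto simp: approx_delta_def\<close>)
        also have "\<dots> = 1 / (a - l) * occupation a \<omega> + (- 1 / (a - l)) * occupation l \<omega>"
          unfolding pt occupation_def
          by (rule time_integral_lincomb[OF \<omega>, where B=1 and C=1]) (auto split: split_indicator)
        also have "\<dots> = (occupation a \<omega> - occupation l \<omega>) / (a - l)"
          by (simp add: diff_divide_distrib)
        finally show "1 * time_integral (p a) \<omega> + 1 * time_integral (n a) \<omega>
          = (occupation a \<omega> - occupation l \<omega>) / (a - l)" .
      qed
    qed
  qed simp
qed

lemma smoothed_occupation_L2:
  assumes A [measurable]: "A \<in> borel_measurable borel"
    and low: "\<And>x. x \<le> -1 \<Longrightarrow> A x = 0" and up: "\<And>x. x \<ge> 1 \<Longrightarrow> A x = 1"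
    and mono: "\<And>x y. x \<le> y \<Longrightarrow> A x \<le> A y" and l: "l \<ge> 0"
  shows "L2_tendsto M (\<lambda>\<epsilon>. time_integral (\<lambda>z. A ((z + l) / \<epsilon>) - A ((z - l) / \<epsilon>))) (occupation l) (at_right 0)"
proof -
  let ?w = "\<lambda>\<epsilon> z. A ((z + l) / \<epsilon>) - A ((z - l) / \<epsilon>)"
  let ?i = "indicator {z. \<bar>z\<bar> \<le> l} :: real \<Rightarrow> real"
  let ?d = "\<lambda>\<epsilon>. indicator {z. \<bar>\<bar>z\<bar> - l\<bar> \<le> \<epsilon>} :: real \<Rightarrow> real"
  let ?V = "measure (N \<Otimes>\<^sub>M N) (space (N \<Otimes>\<^sub>M N))"
  have err: "\<bar>?w \<epsilon> z - ?i z\<bar> \<le> ?d \<epsilon> z" if "\<epsilon> > 0" for \<epsilon> z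
    by (rule smoothed_window_error[OF low up mono that l])
  have wb: "\<bar>?w \<epsilon> z\<bar> \<le> 2" if "\<epsilon> > 0" for \<epsilon> z
    using err[OF that, of z] by (auto split: split_indicator_asm)
  have ev: "\<forall>\<^sub>F \<epsilon> in at_right 0. (0::real) < \<epsilon>"
    by (rule eventually_at_right_less)
  have wsq: "square_integrable M (time_integral (?w \<epsilon>))" if "\<epsilon> > 0" for \<epsilon>
    by (rule square_integrable_time_integral[OF _ wb[OF that]]) measurable
  have osq: "square_integrable M (occupation l)"
    unfolding occupation_def by (rule square_integrable_time_integral[where B=1]) (auto split: split_indicator)
  have dsq: "square_integrable M (time_integral (?d \<epsilon>))" for \<epsilon>
    by (rule square_integrable_time_integral[where B=1]) (auto split: split_indicator)
  have bound: "(LINT \<omega>|M. (time_integral (?w \<epsilon>) \<omega> - occupation l \<omega>)\<^sup>2) \<le> 4 * \<epsilon> * ?V" if e: "\<epsilon> > 0" for \<epsilon>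
  proof -
    have "(LINT \<omega>|M. (time_integral (?w \<epsilon>) \<omega> - occupation l \<omega>)\<^sup>2) \<le> (LINT \<omega>|M. (time_integral (?d \<epsilon>) \<omega>)\<^sup>2)"
    proof (rule integral_mono)
      show "integrable M (\<lambda>\<omega>. (time_integral (?w \<epsilon>) \<omega> - occupation l \<omega>)\<^sup>2)"
        using square_integrable_diff[OF wsq[OF e] osq] by (simp add: square_integrable_def)
      show "integrable M (\<lambda>\<omega>. (time_integral (?d \<epsilon>) \<omega>)\<^sup>2)"
        using dsq by (simp add: square_integrable_def)
      fix \<omega> assume \<omega>: "\<omega> \<in> space M"
      have iw: "integrable N (\<lambda>t. ?w \<epsilon> (Z t \<omega>))"
        by (rule integrable_time[OF _ wb[OF e] \<omega>]) measurable
      have ii: "integrable N (\<lambda>t. ?i (Z t \<omega>))"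
        by (rule integrable_time[where B=1, OF _ _ \<omega>]) (auto split: split_indicator)
      have id: "integrable N (\<lambda>t. ?d \<epsilon> (Z t \<omega>))"
        by (rule integrable_time[where B=1, OF _ _ \<omega>]) (auto split: split_indicator)
      have "\<bar>time_integral (?w \<epsilon>) \<omega> - occupation l \<omega>\<bar> = \<bar>LINT t|N. ?w \<epsilon> (Z t \<omega>) - ?i (Z t \<omega>)\<bar>"
        unfolding occupation_def time_integral_def using iw ii by simp
      also have "\<dots> \<le> (LINT t|N. \<bar>?w \<epsilon> (Z t \<omega>) - ?i (Z t \<omega>)\<bar>)"
        by (rule integral_abs_bound)
      also have "\<dots> \<le> time_integral (?d \<epsilon>) \<omega>"
        unfolding time_integral_def
        by (rule integral_mono[OF integrable_abs[OF Bochner_Integration.integrable_diff[OF iw ii]] id err[OF e]])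
      finally show "(time_integral (?w \<epsilon>) \<omega> - occupation l \<omega>)\<^sup>2 \<le> (time_integral (?d \<epsilon>) \<omega>)\<^sup>2"
        using power_mono[OF _ abs_ge_zero, of "time_integral (?w \<epsilon>) \<omega> - occupation l \<omega>" _ 2]
        unfolding power2_abs by blast
    qed
    also have "\<dots> \<le> 4 * \<epsilon> * ?V"
      using time_near_level_small[of \<epsilon> l] e by simp
    finally show ?thesis .
  qed
  have "((\<lambda>\<epsilon>. 4 * \<epsilon> * ?V) \<longlongrightarrow> 4 * 0 * ?V) (at_right 0)"
    by (intro tendsto_intros)
  then have lim: "((\<lambda>\<epsilon>. 4 * \<epsilon> * ?V) \<longlongrightarrow> 0) (at_right 0)" by simp
  show ?thesis
    unfolding L2_tendsto_def
  proof (intro conjI osq)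
    show "\<forall>\<^sub>F \<epsilon> in at_right 0. square_integrable M (time_integral (?w \<epsilon>))"
      using ev by eventually_elim (rule wsq)
    show "((\<lambda>\<epsilon>. LINT \<omega>|M. (time_integral (?w \<epsilon>) \<omega> - occupation l \<omega>)\<^sup>2) \<longlongrightarrow> 0) (at_right 0)"
    proof (rule tendsto_sandwich[OF _ _ tendsto_const lim])
      show "\<forall>\<^sub>F \<epsilon> in at_right 0. (LINT \<omega>|M. (time_integral (?w \<epsilon>) \<omega> - occupation l \<omega>)\<^sup>2) \<le> 4 * \<epsilon> * ?V"
        using ev by eventually_elim (rule bound)
    qed simp
  qed
qed

text \<open>The rescaled mollifiers centred at \<open>l\<close> and \<open>-l\<close> are probability densities that concentrate at these
  points, so their time integrals converge to the two local times; the smoothed window yields the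
  occupation time.\<close>
lemma gradient_kernel_L2:
  assumes \<phi>: "mollifier \<phi>" and A: "\<And>x. (A has_real_derivative \<phi> x) (at x)"
    and low: "\<And>x. x \<le> -1 \<Longrightarrow> A x = 0" and up: "\<And>x. x \<ge> 1 \<Longrightarrow> A x = 1"
    and mono: "\<And>x y. x \<le> y \<Longrightarrow> A x \<le> A y" and l: "l \<ge> 0"
  shows "\<And>\<epsilon> \<omega>. \<epsilon> > 0 \<Longrightarrow> \<omega> \<in> space M \<Longrightarrow> integrable N (\<lambda>t. gradient_kernel \<phi> A l \<epsilon> (Z t \<omega>))"
    and "L2_tendsto M (\<lambda>\<epsilon>. time_integral (gradient_kernel \<phi> A l \<epsilon>))
      (\<lambda>\<omega>. - occupation l \<omega> + l * (level_local_time l \<omega> + level_local_time (- l) \<omega>)) (at_right 0)"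
proof -
  have Am [measurable]: "A \<in> borel_measurable borel"
    by (intro borel_measurable_continuous_onI continuous_at_imp_continuous_on) (use A in \<open>auto intro: DERIV_isCont\<close>)
  let ?w = "\<lambda>\<epsilon> z. A ((z + l) / \<epsilon>) - A ((z - l) / \<epsilon>)"
  let ?p = "\<lambda>\<epsilon> z. rescale \<phi> \<epsilon> (z - l)" and ?n = "\<lambda>\<epsilon> z. rescale \<phi> \<epsilon> (z - (- l))"
  have pd: "approx_delta l \<epsilon> (?p \<epsilon>)" and nd: "approx_delta (- l) \<epsilon> (?n \<epsilon>)" if "\<epsilon> > 0" for \<epsilon>
    using that by (intro approx_delta_rescale \<phi>; simp)+
  have ev: "\<forall>\<^sub>F \<epsilon> in at_right 0. (0::real) < \<epsilon>"
    by (rule eventually_at_right_less)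
  have r: "((\<lambda>\<epsilon>. \<epsilon>) \<longlongrightarrow> 0) (at_right (0::real))" by simp
  have P: "L2_tendsto M (\<lambda>\<epsilon>. time_integral (?p \<epsilon>)) (level_local_time l) (at_right 0)"
    by (rule L2_tendsto_level_local_time[OF _ r]) (rule eventually_mono[OF ev], rule pd)
  have Q: "L2_tendsto M (\<lambda>\<epsilon>. time_integral (?n \<epsilon>)) (level_local_time (- l)) (at_right 0)"
    by (rule L2_tendsto_level_local_time[OF _ r]) (rule eventually_mono[OF ev], rule nd)
  have O: "L2_tendsto M (\<lambda>\<epsilon>. time_integral (?w \<epsilon>)) (occupation l) (at_right 0)"
    by (rule smoothed_occupation_L2[OF Am low up mono l])
  have rng: "0 \<le> A x \<and> A x \<le> 1" for x
    using mono[of "min x (-1)" x] mono[of x "max x 1"] low[of "min x (-1)"] up[of "max x 1"] by simp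
  have wb: "\<bar>?w \<epsilon> z\<bar> \<le> 1" for \<epsilon> z
    using rng[of "(z + l) / \<epsilon>"] rng[of "(z - l) / \<epsilon>"] by (auto simp: abs_le_iff)
  have parts: "integrable N (\<lambda>t. ?w \<epsilon> (Z t \<omega>))" "integrable N (\<lambda>t. ?p \<epsilon> (Z t \<omega>))"
      "integrable N (\<lambda>t. ?n \<epsilon> (Z t \<omega>))" if e: "\<epsilon> > 0" and \<omega>: "\<omega> \<in> space M" for \<epsilon> \<omega>
  proof -
    show "integrable N (\<lambda>t. ?w \<epsilon> (Z t \<omega>))"
      by (rule integrable_time[OF _ wb \<omega>]) measurable
    obtain Bp where Bp: "\<And>x. \<bar>?p \<epsilon> x\<bar> \<le> Bp" using approx_delta_bounded[OF pd[OF e]] by blast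
    obtain Bn where Bn: "\<And>x. \<bar>?n \<epsilon> x\<bar> \<le> Bn" using approx_delta_bounded[OF nd[OF e]] by blast
    show "integrable N (\<lambda>t. ?p \<epsilon> (Z t \<omega>))"
      by (rule integrable_time[OF approx_deltaD(1)[OF pd[OF e]] Bp \<omega>])
    show "integrable N (\<lambda>t. ?n \<epsilon> (Z t \<omega>))"
      by (rule integrable_time[OF approx_deltaD(1)[OF nd[OF e]] Bn \<omega>])
  qed
  have split: "gradient_kernel \<phi> A l \<epsilon> z = - ?w \<epsilon> z + l * (?n \<epsilon> z + ?p \<epsilon> z)" for \<epsilon> z
    by (simp add: gradient_kernel_def)
  show "integrable N (\<lambda>t. gradient_kernel \<phi> A l \<epsilon> (Z t \<omega>))" if "\<epsilon> > 0" "\<omega> \<in> space M" for \<epsilon> \<omega>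
    unfolding split using parts[OF that]
    by (intro Bochner_Integration.integrable_add Bochner_Integration.integrable_minus integrable_mult_right)
  show "L2_tendsto M (\<lambda>\<epsilon>. time_integral (gradient_kernel \<phi> A l \<epsilon>))
      (\<lambda>\<omega>. - occupation l \<omega> + l * (level_local_time l \<omega> + level_local_time (- l) \<omega>)) (at_right 0)"
  proof (rule L2_tendsto_cong[OF L2_tendsto_lincomb[OF O L2_tendsto_lincomb[OF P Q, of 1 1], of "-1" l]])
    show "\<forall>\<^sub>F \<epsilon> in at_right 0. \<forall>\<omega>\<in>space M. - 1 * time_integral (?w \<epsilon>) \<omega>
        + l * (1 * time_integral (?p \<epsilon>) \<omega> + 1 * time_integral (?n \<epsilon>) \<omega>) = time_integral (gradient_kernel \<phi> A l \<epsilon>) \<omega>"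
      using ev
    proof eventually_elim
      case (elim \<epsilon>)
      show ?case
      proof
        fix \<omega> assume \<omega>: "\<omega> \<in> space M"
        note i = parts[OF elim \<omega>]
        have "(LINT t|N. - ?w \<epsilon> (Z t \<omega>) + l * (?n \<epsilon> (Z t \<omega>) + ?p \<epsilon> (Z t \<omega>)))
           = - (LINT t|N. ?w \<epsilon> (Z t \<omega>)) + l * ((LINT t|N. ?n \<epsilon> (Z t \<omega>)) + (LINT t|N. ?p \<epsilon> (Z t \<omega>)))"
          by (simp only: Bochner_Integration.integral_add[OF Bochner_Integration.integrable_minus[OF i(1)]
                integrable_mult_right[OF Bochner_Integration.integrable_add[OF i(3) i(2)]]]
              Bochner_Integration.integral_minus integral_mult_right_zero Bochner_Integration.integral_add[OF i(3) i(2)])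
        then show "- 1 * time_integral (?w \<epsilon>) \<omega>
          + l * (1 * time_integral (?p \<epsilon>) \<omega> + 1 * time_integral (?n \<epsilon>) \<omega>) = time_integral (gradient_kernel \<phi> A l \<epsilon>) \<omega>"
          unfolding time_integral_def split by simp
      qed
    qed
  qed simp
qed

end

section \<open>The unbiased risk estimate of the hard threshold estimator\<close>

lemma (in prob_space) gaussian_rv_square_integrable:
  assumes "gaussian_rv M Y"
  shows "square_integrable M Y"
  using assms unfolding gaussian_rv_def
proof (elim disjE exE conjE)
  fix \<mu> \<sigma> :: real assume "\<sigma> > 0" and Y: "distributed M lborel Y (normal_density \<mu> \<sigma>)"
  have [measurable]: "Y \<in> borel_measurable M"
    using Y by (simp add: distributed_def)
  have "integrable M (\<lambda>\<omega>. (Y \<omega> - \<mu>)\<^sup>2)"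
    using distributed_integrable[OF Y, of "\<lambda>x. (x - \<mu>)\<^sup>2"] integrable_normal_moment[OF \<open>\<sigma> > 0\<close>, of \<mu> 2] by simp
  then have "square_integrable M (\<lambda>\<omega>. Y \<omega> - \<mu>)" by (simp add: square_integrable_def)
  moreover have "square_integrable M (\<lambda>\<omega>. \<mu>)"
    by (rule square_integrable_bounded[where B="\<bar>\<mu>\<bar>"]) auto
  ultimately show ?thesis
    using square_integrable_lincomb[of M "\<lambda>\<omega>. Y \<omega> - \<mu>" "\<lambda>\<omega>. \<mu>" 1 1] by simp
next
  fix \<mu> assume [measurable]: "Y \<in> borel_measurable M" and Y: "AE \<omega> in M. Y \<omega> = \<mu>"
  have "integrable M (\<lambda>\<omega>. (Y \<omega>)\<^sup>2)"
    by (rule integrable_const_bound[where B="\<mu>\<^sup>2"]) (use Y in \<open>auto elim!: eventually_mono\<close>)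
  then show ?thesis by (simp add: square_integrable_def)
qed

lemma (in prob_space) gaussian_rv_char:
  assumes G: "gaussian_rv M Y" and mean: "(LINT \<omega>|M. Y \<omega>) = 0"
  shows "(CLINT \<omega>|M. iexp (Y \<omega>)) = complex_of_real (exp (- (LINT \<omega>|M. (Y \<omega>)\<^sup>2) / 2))"
  using G unfolding gaussian_rv_def
proof (elim disjE exE conjE)
  fix \<mu> \<sigma> :: real assume \<sigma>: "\<sigma> > 0" and Y: "distributed M lborel Y (normal_density \<mu> \<sigma>)"
  have [measurable]: "Y \<in> borel_measurable M"
    using Y by (simp add: distributed_def)
  have \<mu>: "\<mu> = 0"
    using normal_distributed_expectation[OF \<sigma> Y] mean by simp
  have v: "(LINT \<omega>|M. (Y \<omega>)\<^sup>2) = \<sigma>\<^sup>2"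
    using normal_distributed_variance[OF \<sigma> Y] mean by simp
  have "distributed M lborel (\<lambda>\<omega>. Y \<omega> / \<sigma>) std_normal_density"
    using Y normal_standard_normal_convert[OF \<sigma>, of Y 0] by (simp add: \<mu>)
  then have "distr M lborel (\<lambda>\<omega>. Y \<omega> / \<sigma>) = std_normal_distribution"
    by (simp add: distributed_def)
  moreover have "distr M lborel (\<lambda>\<omega>. Y \<omega> / \<sigma>) = distr M borel (\<lambda>\<omega>. Y \<omega> / \<sigma>)"
    by (rule distr_cong) auto
  ultimately have law: "distr M borel (\<lambda>\<omega>. Y \<omega> / \<sigma>) = std_normal_distribution" by simp
  have "(CLINT \<omega>|M. iexp (Y \<omega>)) = char (distr M borel (\<lambda>\<omega>. Y \<omega> / \<sigma>)) \<sigma>"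
    unfolding char_def using \<sigma> by (subst integral_distr) auto
  then show ?thesis
    unfolding law char_std_normal_distribution v .
next
  fix \<mu> assume [measurable]: "Y \<in> borel_measurable M" and Y: "AE \<omega> in M. Y \<omega> = \<mu>"
  have "(LINT \<omega>|M. Y \<omega>) = (LINT \<omega>|M. \<mu>)"
    using Y by (intro integral_cong_AE) auto
  then have "\<mu> = 0" using mean by (simp add: prob_space)
  with Y have Y0: "AE \<omega> in M. Y \<omega> = 0" by simp
  have "(LINT \<omega>|M. (Y \<omega>)\<^sup>2) = (LINT \<omega>|M. 0)"
    using Y0 by (intro integral_cong_AE) auto
  moreover have "(CLINT \<omega>|M. iexp (Y \<omega>)) = (CLINT \<omega>|M. 1)"
    using Y0 by (intro integral_cong_AE) auto
  ultimately show ?thesis by (simp add: prob_space)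
qed

lemma normalized_process_unit_gaussian:
  fixes M :: "'w measure" and X :: "real \<Rightarrow> 'w \<Rightarrow> real" and u \<alpha> :: "real \<Rightarrow> real"
    and \<gamma> :: "real \<Rightarrow> real \<Rightarrow> real" and T :: real
  defines "N \<equiv> restrict_space lborel {0..T}"
  assumes M: "prob_space M"
    and X: "(\<lambda>(t, \<omega>). X t \<omega>) \<in> borel_measurable (restrict_space borel {0..T} \<Otimes>\<^sub>M M)"
    and u: "u \<in> borel_measurable (restrict_space borel {0..T})"
    and G: "centered_gaussian_process M {0..T} (\<lambda>t \<omega>. X t \<omega> - u t)"
    and \<gamma>: "\<And>s t. s \<in> {0..T} \<Longrightarrow> t \<in> {0..T} \<Longrightarrow>
           \<gamma> s t = (LINT \<omega>|M. (X s \<omega> - u s) * (X t \<omega> - u t))"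
    and pos: "\<And>t. t \<in> {0..T} \<Longrightarrow> \<gamma> t t > 0"
    and \<alpha>: "\<alpha> \<in> borel_measurable (restrict_space borel {0..T})"
    and energy: "local_time_condition M T (normalized \<gamma> \<alpha> X)"
  shows "(\<lambda>t. \<gamma> t t) \<in> borel_measurable N"
    and "unit_gaussian_process M N (\<lambda>t \<omega>. (X t \<omega> - u t) / sqrt (\<gamma> t t)) (\<lambda>t. (u t - \<alpha> t) / sqrt (\<gamma> t t))"
proof -
  interpret prob_space M by fact
  interpret N: finite_measure N
    unfolding N_def by (rule finite_measureI) (simp add: space_restrict_space emeasure_restrict_space emeasure_lborel_Icc_eq)
  let ?\<sigma> = "\<lambda>t. sqrt (\<gamma> t t)"
  let ?W = "\<lambda>t \<omega>. (X t \<omega> - u t) / ?\<sigma> t"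
  have sN: "sets N = sets (restrict_space borel {0..T})"
    unfolding N_def by (rule sets_restrict_space_cong) simp
  have spN [simp]: "space N = {0..T}" by (simp add: N_def space_restrict_space)
  have [measurable]: "u \<in> borel_measurable N" "\<alpha> \<in> borel_measurable N"
    using u \<alpha> by (simp_all add: measurable_cong_sets[OF sN refl])
  have Xm [measurable]: "(\<lambda>p. X (fst p) (snd p)) \<in> borel_measurable (N \<Otimes>\<^sub>M M)"
    using X by (simp add: measurable_cong_sets[OF sets_pair_measure_cong[OF sN refl] refl] split_beta')
  have Xt [measurable]: "X t \<in> borel_measurable M" if "t \<in> {0..T}" for t
    using measurable_compose[OF measurable_Pair1' Xm, of t] that by simp
  have "(\<lambda>t. LINT \<omega>|M. (X t \<omega> - u t) * (X t \<omega> - u t)) \<in> borel_measurable N"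
    by measurable
  then show gm: "(\<lambda>t. \<gamma> t t) \<in> borel_measurable N"
    by (rule measurable_cong[THEN iffD1, rotated]) (simp add: \<gamma>)
  note [measurable] = gm
  have \<sigma>: "?\<sigma> t > 0" "?\<sigma> t * ?\<sigma> t = \<gamma> t t" if "t \<in> {0..T}" for t
    using pos[OF that] by auto
  have W: "square_integrable M (?W t)" "(LINT \<omega>|M. ?W t \<omega>) = 0" if t: "t \<in> {0..T}" for t
  proof -
    have "gaussian_rv M (\<lambda>\<omega>. \<Sum>t\<in>{t}. 1 * (X t \<omega> - u t))"
      using G t unfolding centered_gaussian_process_def
      by (elim conjE allE[of _ "{t}"] allE[of _ "\<lambda>_. 1"]) auto
    then have "square_integrable M (\<lambda>\<omega>. X t \<omega> - u t)"
      using gaussian_rv_square_integrable by simp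
    from square_integrable_lincomb[OF this this, of "1 / ?\<sigma> t" 0] show "square_integrable M (?W t)" by simp
    have "(LINT \<omega>|M. X t \<omega> - u t) = 0"
      using G t unfolding centered_gaussian_process_def by blast
    then show "(LINT \<omega>|M. ?W t \<omega>) = 0" by simp
  qed
  have Wi: "integrable M (?W t)" if "t \<in> {0..T}" for t
    using W(1)[OF that] square_integrable_imp_integrable by (auto simp: square_integrable_def)
  have WW: "integrable M (\<lambda>\<omega>. ?W s \<omega> * ?W t \<omega>)" if "s \<in> {0..T}" "t \<in> {0..T}" for s t
    by (rule square_integrable_mult) (use W that in auto)
  have unit: "(LINT \<omega>|M. (?W t \<omega>)\<^sup>2) = 1" if "t \<in> {0..T}" for t
    using \<gamma>[OF that that] \<sigma>[OF that] pos[OF that] by (simp add: power_divide power2_eq_square)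
  have sq: "(LINT \<omega>|M. (a * ?W s \<omega> + b * ?W t \<omega>)\<^sup>2) = a\<^sup>2 + 2 * a * b * corr M ?W s t + b\<^sup>2"
    if s: "s \<in> {0..T}" and t: "t \<in> {0..T}" for s t a b
  proof -
    have "(LINT \<omega>|M. (a * ?W s \<omega> + b * ?W t \<omega>)\<^sup>2)
        = (LINT \<omega>|M. a\<^sup>2 * (?W s \<omega>)\<^sup>2 + (2 * a * b) * (?W s \<omega> * ?W t \<omega>) + b\<^sup>2 * (?W t \<omega>)\<^sup>2)"
      by (intro Bochner_Integration.integral_cong refl) (simp add: power2_eq_square algebra_simps)
    also have "\<dots> = a\<^sup>2 * (LINT \<omega>|M. (?W s \<omega>)\<^sup>2) + (2 * a * b) * (LINT \<omega>|M. ?W s \<omega> * ?W t \<omega>)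
        + b\<^sup>2 * (LINT \<omega>|M. (?W t \<omega>)\<^sup>2)"
      using W(1)[OF s] W(1)[OF t] WW[OF s t] unfolding square_integrable_def
      by (simp only: Bochner_Integration.integral_add Bochner_Integration.integrable_add
          integrable_mult_right integral_mult_right_zero simp_thms)
    finally show ?thesis by (simp only: unit[OF s] unit[OF t] corr_def)
  qed
  show "unit_gaussian_process M N ?W (\<lambda>t. (u t - \<alpha> t) / ?\<sigma> t)"
  proof unfold_locales
    show "(\<lambda>(t, \<omega>). ?W t \<omega>) \<in> borel_measurable (N \<Otimes>\<^sub>M M)"
      unfolding split_beta' by measurable
    show "(\<lambda>t. (u t - \<alpha> t) / ?\<sigma> t) \<in> borel_measurable N" by measurable
    fix s t a b assume "s \<in> space N" "t \<in> space N"
    then have s: "s \<in> {0..T}" and t: "t \<in> {0..T}" by auto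
    \<comment> \<open>The two contributions add up when \<open>s = t\<close>.\<close>
    define c where "c r = (if r = s then a / ?\<sigma> s else 0) + (if r = t then b / ?\<sigma> t else 0)" for r
    have sum: "(\<Sum>r\<in>{s, t}. c r * (X r \<omega> - u r)) = a * ?W s \<omega> + b * ?W t \<omega>" for \<omega>
      by (cases "s = t") (auto simp: c_def algebra_simps add_divide_distrib diff_divide_distrib)
    have "gaussian_rv M (\<lambda>\<omega>. \<Sum>r\<in>{s, t}. c r * (X r \<omega> - u r))"
      using G s t unfolding centered_gaussian_process_def
      by (elim conjE allE[of _ "{s, t}"] allE[of _ c]) auto
    then have "gaussian_rv M (\<lambda>\<omega>. a * ?W s \<omega> + b * ?W t \<omega>)" unfolding sum .
    moreover have "(LINT \<omega>|M. a * ?W s \<omega> + b * ?W t \<omega>) = 0"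
      using Wi[OF s] Wi[OF t] W(2)[OF s] W(2)[OF t]
      by (simp only: Bochner_Integration.integral_add integrable_mult_right integral_mult_right_zero mult_zero_right add_0)
    ultimately show "(CLINT \<omega>|M. iexp (a * ?W s \<omega> + b * ?W t \<omega>))
        = complex_of_real (exp (- (a\<^sup>2 + 2 * a * b * corr M ?W s t + b\<^sup>2) / 2))"
      using gaussian_rv_char[of "\<lambda>\<omega>. a * ?W s \<omega> + b * ?W t \<omega>"] unfolding sq[OF s t] by simp
  next
    have var: "variance (\<lambda>\<omega>. normalized \<gamma> \<alpha> X t \<omega> - normalized \<gamma> \<alpha> X s \<omega>) = 2 - 2 * corr M ?W s t"
      if s: "s \<in> {0..T}" and t: "t \<in> {0..T}" for s t
    proof -
      let ?c = "(u t - \<alpha> t) / ?\<sigma> t - (u s - \<alpha> s) / ?\<sigma> s"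
      have d: "normalized \<gamma> \<alpha> X t \<omega> - normalized \<gamma> \<alpha> X s \<omega> = (?W t \<omega> - ?W s \<omega>) + ?c" for \<omega>
        by (simp add: normalized_def diff_divide_distrib)
      have "expectation (\<lambda>\<omega>. normalized \<gamma> \<alpha> X t \<omega> - normalized \<gamma> \<alpha> X s \<omega>) = ?c"
        unfolding d using Wi[OF s] Wi[OF t] W(2)[OF s] W(2)[OF t]
        by (simp only: Bochner_Integration.integral_add Bochner_Integration.integral_diff
            Bochner_Integration.integrable_diff integrable_const lebesgue_integral_const) (simp add: prob_space)
      then have "variance (\<lambda>\<omega>. normalized \<gamma> \<alpha> X t \<omega> - normalized \<gamma> \<alpha> X s \<omega>)
          = expectation (\<lambda>\<omega>. (?W t \<omega> - ?W s \<omega>)\<^sup>2)"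
        unfolding d by (simp only: add_diff_cancel_right')
      also have "\<dots> = 2 - 2 * corr M ?W s t"
      proof -
        have "(-1) * v + 1 * w = w - v" for v w :: real by simp
        from sq[OF s t, of "-1" 1, unfolded this] show ?thesis by simp
      qed
      finally show ?thesis .
    qed
    have "(\<integral>\<^sup>+s. (\<integral>\<^sup>+t. inverse (ennreal (sqrt (2 - 2 * corr M ?W s t))) \<partial>N) \<partial>N)
        = (\<integral>\<^sup>+s. (\<integral>\<^sup>+t. inverse (ennreal (sqrt (variance (\<lambda>\<omega>. normalized \<gamma> \<alpha> X t \<omega> - normalized \<gamma> \<alpha> X s \<omega>)))) \<partial>N) \<partial>N)"
      by (intro nn_integral_cong) (simp add: var)
    also have "\<dots> < \<infinity>"
      using energy unfolding local_time_condition_def N_def by (simp add: nn_integral_restrict_space)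
    finally show "(\<integral>\<^sup>+s. (\<integral>\<^sup>+t. inverse (ennreal (sqrt (2 - 2 * corr M ?W s t))) \<partial>N) \<partial>N) < \<infinity>" .
  qed
qed

lemma risk_measure_integral:
  fixes f g :: "real \<Rightarrow> real" and T :: real
  defines "N \<equiv> restrict_space lborel {0..T}"
  assumes [measurable]: "(\<lambda>t. \<gamma> t t) \<in> borel_measurable N" "g \<in> borel_measurable N"
    and pos: "\<And>t. t \<in> {0..T} \<Longrightarrow> \<gamma> t t > 0"
    and f: "\<And>t. t \<in> {0..T} \<Longrightarrow> f t = \<gamma> t t * g t"
  shows "(LINT t|risk_measure T \<gamma>. f t) = (LINT t|N. g t)"
    and "integrable (risk_measure T \<gamma>) f \<longleftrightarrow> integrable N g"
proof -
  have sp: "space N = {0..T}" by (simp add: N_def space_restrict_space)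
  have R: "risk_measure T \<gamma> = density N (\<lambda>t. ennreal (1 / \<gamma> t t))"
    by (simp add: risk_measure_def N_def)
  have nn: "AE t in N. 0 \<le> 1 / \<gamma> t t"
    using pos by (intro AE_I2) (simp add: sp less_imp_le)
  have [measurable]: "(\<lambda>t. \<gamma> t t * g t) \<in> borel_measurable N" by measurable
  then have fm [measurable]: "f \<in> borel_measurable N"
    by (rule measurable_cong[THEN iffD1, rotated]) (simp add: sp f)
  have dm: "(\<lambda>t. 1 / \<gamma> t t) \<in> borel_measurable N" by measurable
  have e: "(1 / \<gamma> t t) *\<^sub>R f t = g t" if "t \<in> space N" for t
    using that pos[of t] by (simp add: sp f)
  show "(LINT t|risk_measure T \<gamma>. f t) = (LINT t|N. g t)"
    unfolding R by (subst integral_density[OF fm dm nn]) (rule Bochner_Integration.integral_cong[OF refl e])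
  show "integrable (risk_measure T \<gamma>) f \<longleftrightarrow> integrable N g"
    unfolding R by (subst integrable_density[OF fm dm nn]) (rule Bochner_Integration.integrable_cong[OF refl e])
qed

text \<open>The change of variable \<open>z = (x - \<alpha> t) / \<surd>(\<gamma> t t)\<close> turns the mollification scale
  \<open>\<epsilon> \<surd>(\<gamma> t t)\<close> into \<open>\<epsilon>\<close>, and the jump height \<open>l \<surd>(\<gamma> t t)\<close> cancels against the
  normalization of the mollifier. So the kernel is the same for all times.\<close>
lemma grad_mollify_hard_threshold:
  assumes \<phi>: "mollifier \<phi>" and A: "\<And>x. (A has_real_derivative \<phi> x) (at x)"
    and e: "\<epsilon> > 0" and l: "l \<ge> 0" and pos: "\<gamma> t t > 0"
  shows "grad \<gamma> (mollify \<gamma> \<phi> \<epsilon> (hard_threshold \<gamma> \<alpha> l)) t x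
    = \<gamma> t t * gradient_kernel \<phi> A l \<epsilon> ((x - \<alpha> t) / sqrt (\<gamma> t t))"
proof -
  let ?\<sigma> = "sqrt (\<gamma> t t)"
  have \<sigma>: "?\<sigma> > 0" using pos by simp
  have "(mollify \<gamma> \<phi> \<epsilon> (hard_threshold \<gamma> \<alpha> l) t has_real_derivative
      - (A ((x - \<alpha> t + l * ?\<sigma>) / (\<epsilon> * ?\<sigma>)) - A ((x - \<alpha> t - l * ?\<sigma>) / (\<epsilon> * ?\<sigma>)))
      + l * ?\<sigma> * (rescale \<phi> (\<epsilon> * ?\<sigma>) (x - \<alpha> t + l * ?\<sigma>) + rescale \<phi> (\<epsilon> * ?\<sigma>) (x - \<alpha> t - l * ?\<sigma>))) (at x)"
    unfolding mollify_def hard_threshold_def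
    by (rule convolve_threshold_has_derivative[OF mollifierD(3)[OF \<phi>] A]) (use e l \<sigma> in auto)
  moreover have p: "(x - \<alpha> t + l * ?\<sigma>) / (\<epsilon> * ?\<sigma>) = ((x - \<alpha> t) / ?\<sigma> + l) / \<epsilon>"
    "(x - \<alpha> t - l * ?\<sigma>) / (\<epsilon> * ?\<sigma>) = ((x - \<alpha> t) / ?\<sigma> - l) / \<epsilon>"
    using \<sigma> e by (auto simp: field_simps)
  have r: "l * ?\<sigma> * (rescale \<phi> (\<epsilon> * ?\<sigma>) (x - \<alpha> t + l * ?\<sigma>) + rescale \<phi> (\<epsilon> * ?\<sigma>) (x - \<alpha> t - l * ?\<sigma>))
      = l * (rescale \<phi> \<epsilon> ((x - \<alpha> t) / ?\<sigma> + l) + rescale \<phi> \<epsilon> ((x - \<alpha> t) / ?\<sigma> - l))"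
    unfolding rescale_def p using \<sigma> e by (simp add: field_simps)
  ultimately show ?thesis
    unfolding grad_def gradient_kernel_def p r by (simp add: DERIV_imp_deriv)
qed

theorem proposition5p1:
  fixes M :: "'w measure"
    and T lam :: real
    and X :: "real \<Rightarrow> 'w \<Rightarrow> real"
    and u \<alpha> \<phi> :: "real \<Rightarrow> real"
    and \<gamma> :: "real \<Rightarrow> real \<Rightarrow> real"
  assumes "prob_space M"
    and "T > 0"
    and "(\<lambda>(t, \<omega>). X t \<omega>) \<in> borel_measurable (restrict_space borel {0..T} \<Otimes>\<^sub>M M)"
    and "u \<in> borel_measurable (restrict_space borel {0..T})"
    and "centered_gaussian_process M {0..T} (\<lambda>t \<omega>. X t \<omega> - u t)"
    and "\<And>s t. s \<in> {0..T} \<Longrightarrow> t \<in> {0..T} \<Longrightarrow>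
           \<gamma> s t = (LINT \<omega>|M. (X s \<omega> - u s) * (X t \<omega> - u t))"
    and "\<And>t. t \<in> {0..T} \<Longrightarrow> \<gamma> t t > 0"
    and "\<alpha> \<in> borel_measurable (restrict_space borel {0..T})"
    and "lam \<ge> 0"
    and "local_time_condition M T (normalized \<gamma> \<alpha> X)"
    and "mollifier \<phi>"
  shows "(\<exists>\<L>. is_local_time M T \<gamma> \<alpha> X lam \<L>)
    \<and> (\<exists>\<D>. is_grad_integral M \<gamma> (risk_measure T \<gamma>) \<phi> X (hard_threshold \<gamma> \<alpha> lam) \<D>)
    \<and> (\<forall>\<L> \<D>. is_local_time M T \<gamma> \<alpha> X lam \<L>
        \<and> is_grad_integral M \<gamma> (risk_measure T \<gamma>) \<phi> X (hard_threshold \<gamma> \<alpha> lam) \<D> \<longrightarrow>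
        (AE \<omega> in M.
          SURE \<gamma> (risk_measure T \<gamma>) X (hard_threshold \<gamma> \<alpha> lam) \<D> \<omega> =
            T
            + (LINT t:{0..T}|lborel. (X t \<omega> - \<alpha> t)\<^sup>2 / \<gamma> t t *
                (if \<bar>X t \<omega> - \<alpha> t\<bar> \<le> lam * sqrt (\<gamma> t t) then 1 else 0))
            + 2 * lam * \<L> \<omega> - 2 * occupation_time T \<gamma> \<alpha> X lam \<omega>))"
proof -
  let ?N = "restrict_space lborel {0..T}"
  let ?\<sigma> = "\<lambda>t. sqrt (\<gamma> t t)"
  let ?W = "\<lambda>t \<omega>. (X t \<omega> - u t) / ?\<sigma> t" and ?m = "\<lambda>t. (u t - \<alpha> t) / ?\<sigma> t"
  let ?\<mu> = "risk_measure T \<gamma>" and ?\<xi> = "hard_threshold \<gamma> \<alpha> lam"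
  have gm [measurable]: "(\<lambda>t. \<gamma> t t) \<in> borel_measurable ?N"
    by (rule normalized_process_unit_gaussian(1)[of M X T u \<gamma> \<alpha>]; fact assms)
  note pos = assms(7)
  interpret G: unit_gaussian_process M ?N ?W ?m
    by (rule normalized_process_unit_gaussian(2); fact assms)
  have spN [simp]: "space ?N = {0..T}" by (simp add: space_restrict_space)
  have Z: "G.Z t \<omega> = (X t \<omega> - \<alpha> t) / ?\<sigma> t" for t \<omega>
    unfolding G.Z_def by (simp add: diff_divide_distrib)
  have level: "\<bar>X t \<omega> - \<alpha> t\<bar> \<le> a * ?\<sigma> t \<longleftrightarrow> \<bar>G.Z t \<omega>\<bar> \<le> a"
    "\<bar>X t \<omega> - \<alpha> t\<bar> < a * ?\<sigma> t \<longleftrightarrow> \<bar>G.Z t \<omega>\<bar> < a" if "t \<in> {0..T}" for t \<omega> a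
    using pos[OF that] by (simp_all add: Z abs_divide pos_divide_le_eq pos_divide_less_eq)
  have set_N: "(LINT t:{0..T}|lborel. f t) = (LINT t|?N. f t)" for f :: "real \<Rightarrow> real"
    by (simp add: set_lebesgue_integral_def integral_restrict_space)
  have occ: "occupation_time T \<gamma> \<alpha> X a \<omega> = G.occupation a \<omega>" for a \<omega>
    unfolding occupation_time_def set_N G.occupation_def G.time_integral_def
    by (intro Bochner_Integration.integral_cong refl) (simp add: level indicator_def)
  define L0 where "L0 \<omega> = G.level_local_time lam \<omega> + G.level_local_time (- lam) \<omega>" for \<omega>
  have L0: "is_local_time M T \<gamma> \<alpha> X lam L0"
    unfolding is_local_time_def occ L0_def[abs_def]
    by (rule G.occupation_has_L2_derivative) fact
  obtain A where A: "\<And>x. (A has_real_derivative \<phi> x) (at x)"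
    and low: "\<And>x. x \<le> -1 \<Longrightarrow> A x = 0" and up: "\<And>x. x \<ge> 1 \<Longrightarrow> A x = 1"
    and mono: "\<And>x y. x \<le> y \<Longrightarrow> A x \<le> A y"
    using mollifier_antiderivative[OF assms(11)] by blast
  have kernel_integrable: "integrable ?N (\<lambda>t. gradient_kernel \<phi> A lam \<epsilon> (G.Z t \<omega>))"
    if "\<epsilon> > 0" "\<omega> \<in> space M" for \<epsilon> \<omega>
    by (rule G.gradient_kernel_L2(1); (fact assms(11) A low up mono assms(9) that | assumption))
  have kernel_L2: "L2_tendsto M (\<lambda>\<epsilon>. G.time_integral (gradient_kernel \<phi> A lam \<epsilon>))
      (\<lambda>\<omega>. - G.occupation lam \<omega> + lam * (G.level_local_time lam \<omega> + G.level_local_time (- lam) \<omega>)) (at_right 0)"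
    by (rule G.gradient_kernel_L2(2); (fact assms(11) A low up mono assms(9) | assumption))
  have grad: "integrable ?\<mu> (\<lambda>t. grad \<gamma> (mollify \<gamma> \<phi> \<epsilon> ?\<xi>) t (X t \<omega>))"
    "(LINT t|?\<mu>. grad \<gamma> (mollify \<gamma> \<phi> \<epsilon> ?\<xi>) t (X t \<omega>)) = G.time_integral (gradient_kernel \<phi> A lam \<epsilon>) \<omega>"
    if e: "\<epsilon> > 0" and \<omega>: "\<omega> \<in> space M" for \<epsilon> \<omega>
  proof -
    let ?g = "\<lambda>t. gradient_kernel \<phi> A lam \<epsilon> (G.Z t \<omega>)"
    have int: "integrable ?N ?g" by (rule kernel_integrable[OF e \<omega>])
    have eq: "grad \<gamma> (mollify \<gamma> \<phi> \<epsilon> ?\<xi>) t (X t \<omega>) = \<gamma> t t * ?g t" if "t \<in> {0..T}" for t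
      unfolding Z by (rule grad_mollify_hard_threshold[where \<gamma>=\<gamma> and t=t, OF assms(11) A e assms(9) pos[OF that]])
    note r = risk_measure_integral[where \<gamma>=\<gamma> and T=T and g="?g" and f="\<lambda>t. grad \<gamma> (mollify \<gamma> \<phi> \<epsilon> ?\<xi>) t (X t \<omega>)", OF gm borel_measurable_integrable[OF int] pos eq]
    show "integrable ?\<mu> (\<lambda>t. grad \<gamma> (mollify \<gamma> \<phi> \<epsilon> ?\<xi>) t (X t \<omega>))"
      using r(2) int by simp
    show "(LINT t|?\<mu>. grad \<gamma> (mollify \<gamma> \<phi> \<epsilon> ?\<xi>) t (X t \<omega>)) = G.time_integral (gradient_kernel \<phi> A lam \<epsilon>) \<omega>"
      using r(1) by (simp add: G.time_integral_def)
  qed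
  define D0 where "D0 \<omega> = - G.occupation lam \<omega> + lam * L0 \<omega>" for \<omega>
  have D0: "is_grad_integral M \<gamma> ?\<mu> \<phi> X ?\<xi> D0"
    unfolding is_grad_integral_def
  proof (intro conjI allI impI)
    show "AE \<omega> in M. integrable ?\<mu> (\<lambda>t. grad \<gamma> (mollify \<gamma> \<phi> \<epsilon> ?\<xi>) t (X t \<omega>))" if "\<epsilon> > 0" for \<epsilon>
      by (rule AE_I2) (rule grad(1)[OF that])
    show "L2_tendsto M (\<lambda>\<epsilon> \<omega>. LINT t|?\<mu>. grad \<gamma> (mollify \<gamma> \<phi> \<epsilon> ?\<xi>) t (X t \<omega>)) D0 (at_right 0)"
    proof (rule L2_tendsto_cong[OF kernel_L2])
      show "\<forall>\<^sub>F \<epsilon> in at_right 0. \<forall>\<omega>\<in>space M. G.time_integral (gradient_kernel \<phi> A lam \<epsilon>) \<omega>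
          = (LINT t|?\<mu>. grad \<gamma> (mollify \<gamma> \<phi> \<epsilon> ?\<xi>) t (X t \<omega>))"
        using eventually_at_right_less[of "0::real"] by eventually_elim (simp add: grad(2))
    qed (simp add: D0_def L0_def)
  qed
  \<comment> \<open>The right neighbours of \<open>lam\<close> lie in the half-line, so limits along this filter are unique.\<close>
  have nontriv: "at lam within {0..} \<noteq> bot"
  proof
    assume "at lam within {0..} = bot"
    moreover have "at_right lam \<le> at lam within {0..}"
      using assms(9) by (intro at_le) auto
    ultimately show False by (simp add: bot_unique)
  qed
  have "AE \<omega> in M. SURE \<gamma> ?\<mu> X ?\<xi> \<D> \<omega> =
            T
            + (LINT t:{0..T}|lborel. (X t \<omega> - \<alpha> t)\<^sup>2 / \<gamma> t t *
                (if \<bar>X t \<omega> - \<alpha> t\<bar> \<le> lam * sqrt (\<gamma> t t) then 1 else 0))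
            + 2 * lam * \<L> \<omega> - 2 * occupation_time T \<gamma> \<alpha> X lam \<omega>"
    if L: "is_local_time M T \<gamma> \<alpha> X lam \<L>" and D: "is_grad_integral M \<gamma> ?\<mu> \<phi> X ?\<xi> \<D>" for \<L> \<D>
  proof -
    have "AE \<omega> in M. \<L> \<omega> = L0 \<omega>"
      using L2_tendsto_unique[OF nontriv] L L0 unfolding is_local_time_def by blast
    moreover have "AE \<omega> in M. \<D> \<omega> = D0 \<omega>"
      using L2_tendsto_unique[OF trivial_limit_at_right_real] D D0 unfolding is_grad_integral_def by blast
    ultimately show ?thesis
      using G.AE_time_off_level[of lam] AE_space
    proof eventually_elim
      case (elim \<omega>)
      let ?q = "\<lambda>t. (G.Z t \<omega>)\<^sup>2 * (if \<bar>G.Z t \<omega>\<bar> < lam then 1 else 0)"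
      have [measurable]: "(\<lambda>t. G.Z t \<omega>) \<in> borel_measurable ?N"
        using elim(4) by measurable
      have sqZ: "(X t \<omega> - \<alpha> t)\<^sup>2 = \<gamma> t t * (G.Z t \<omega>)\<^sup>2" if "t \<in> {0..T}" for t
        using pos[OF that] by (simp add: Z power_divide)
      have 1: "(LINT t|?\<mu>. \<gamma> t t) = T"
        using risk_measure_integral(1)[where \<gamma>=\<gamma> and T=T and g="\<lambda>_. 1" and f="\<lambda>t. \<gamma> t t", OF gm _ pos] assms(2)
        by (simp add: measure_restrict_space)
      have 2: "(LINT t|?\<mu>. \<bar>?\<xi> t (X t \<omega>)\<bar>\<^sup>2) = (LINT t|?N. ?q t)"
        by (rule risk_measure_integral(1)[where \<gamma>=\<gamma> and T=T, OF gm _ pos])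
           (auto simp: hard_threshold_def level sqZ power2_commute[of "\<alpha> _"])
      have 3: "(LINT t:{0..T}|lborel. (X t \<omega> - \<alpha> t)\<^sup>2 / \<gamma> t t *
                (if \<bar>X t \<omega> - \<alpha> t\<bar> \<le> lam * sqrt (\<gamma> t t) then 1 else 0))
          = (LINT t|?N. (G.Z t \<omega>)\<^sup>2 * (if \<bar>G.Z t \<omega>\<bar> \<le> lam then 1 else 0))"
        unfolding set_N
      proof (intro Bochner_Integration.integral_cong refl)
        fix t assume "t \<in> space ?N"
        then have t: "t \<in> {0..T}" by simp
        show "(X t \<omega> - \<alpha> t)\<^sup>2 / \<gamma> t t * (if \<bar>X t \<omega> - \<alpha> t\<bar> \<le> lam * sqrt (\<gamma> t t) then 1 else 0)
            = (G.Z t \<omega>)\<^sup>2 * (if \<bar>G.Z t \<omega>\<bar> \<le> lam then 1 else 0)"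
          using pos[OF t] by (simp add: level[OF t] sqZ[OF t])
      qed
      \<comment> \<open>The strict and the weak inequality differ only where \<open>\<bar>Z t\<bar> = lam\<close>.\<close>
      also have "\<dots> = (LINT t|?N. ?q t)"
      proof (rule integral_cong_AE)
        show "AE t in ?N. (G.Z t \<omega>)\<^sup>2 * (if \<bar>G.Z t \<omega>\<bar> \<le> lam then 1 else 0) = ?q t"
          using elim(3) by eventually_elim auto
      qed measurable
      finally show ?case
        using 1 2 elim(1,2) by (simp add: SURE_def occ D0_def algebra_simps)
    qed
  qed
  with L0 D0 show ?thesis by blast
qed

end
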